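(* Let $\mathbb A$ be an algebra on $\mathbb R^3$ with unit $e$, $F$ an $\mathbb A$-algebrizable vector field defined on an open set $\Omega\subset\mathbb R^3$, $w_0\in\Omega(F,\mathbb A^* )$, and $N(w_0)$ a simply connected open set containing $w_0$ and contained in $\Omega(F,\mathbb A^* )$. A function $H=(h_1,h_2,h_3)$ on $N(w_0)$ is an $\mathbb A$-antiderivative of $\frac{e}{F}$ on $N(w_0)$ if and only if for all $w\in N(w_0)$ $$H(w)=H(w_0)+\left(\int_{w_0}^w G_1\cdot ds,\int_{w_0}^w G_2\cdot ds,\int_{w_0}^w G_3\cdot ds\right).$$ If $H=(h_1,h_2,h_3)$ is an $\mathbb A$-antiderivative of $\frac{e}{F}$ on $N(w_0)$, then a pair of first integrals for $F$ on $N(w_0)$ is given as follows, where $\{r,s,t\}=\{1,2,3\}$: (1) $h_s$ and $h_t$, when $\mathbb A=\mathbb A^3_r(p_1,\dots,p_6)$; (2) $h_r-h_s$ and $h_r-h_s+h_t$, when $\mathbb A=\mathbb A^3_{r,s}(p_1,p_2)$; (3) $h_r-h_t$ and $h_r-h_s$, when $\mathbb A=\mathbb A^3_{1,2,3}$. Moreover, these pairs of first integrals have transversal intersections.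
   Context: An algebra $\mathbb A$ on $\mathbb R^3$ is the linear space $\mathbb R^3$ (canonical basis $e_1,e_2,e_3$) endowed with a bilinear, associative, commutative product with unit $e$; its structure constants $c_{ijk}$ are defined by $e_ie_j=\sum_{k}c_{ijk}e_k$. $\mathbb A^*$ is the set of invertible elements, the inverse of $a$ being $\frac ea$. A function or vector field $F:\Omega\to\mathbb R^3$, $\Omega\subset\mathbb R^3$ open, is $\mathbb A$-algebrizable if there is $F':\Omega\to\mathbb R^3$ (its $\mathbb A$-derivative) with $\lim_{\xi\to0}|F(w+\xi)-F(w)-F'(w)\xi|/|\xi|=0$ for all $w\in\Omega$ (product in $\mathbb A$). An $\mathbb A$-antiderivative of $K$ is an $\mathbb A$-algebrizable function $H$ with $H'=K$. $\Omega(F,\mathbb A^* )=F^{-1}(\mathbb A^* )$ and $\frac eF$ is the function $w\mapsto F(w)^{-1}$ on it. Writing $\frac eF=(g_1,g_2,g_3)$, the vector fields $G_k$ are $G_k=\sum_{j=1}^3\sum_{i=1}^3c_{ijk}\,g_i\,e_j$, $k=1,2,3$. $\int_{w_0}^wG\cdot ds$ is the usual line integral $\int\langle G(\gamma(t)),\dot\gamma(t)\rangle dt$ along any (piecewise continuously) differentiable curve $\gamma$ in $N(w_0)$ from $w_0$ to $w$. A first integral of $F$ is a differentiable real function $h$ with $\langle\nabla h,F\rangle=0$. Two differentiable functions $h,k$ on an open set have transversal intersections if any two level surfaces $h^{-1}(c_1)$, $k^{-1}(c_2)$ with nonempty intersection intersect transversally. Families of algebras ($\{r,s,t\}=\{1,2,3\}$,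 all parameters real): $\bullet$ $\mathbb A^3_r(p_1,\dots,p_6)$: unit $e=e_r$, commutative product with $e_se_s=p_7e_r+p_1e_s+p_2e_t$, $e_se_t=p_8e_r+p_3e_s+p_4e_t$, $e_te_t=p_9e_r+p_5e_s+p_6e_t$, where $p_7=p_2p_3+p_4^2-p_1p_4-p_2p_6$, $p_8=p_2p_5-p_3p_4$, $p_9=p_3^2+p_4p_5-p_1p_5-p_3p_6$. $\bullet$ $\mathbb A^3_{r,s}(p_1,p_2)$: unit $e=e_r+e_s$, commutative product with $e_re_r=e_r$, $e_re_s=e_re_t=0$, $e_se_s=e_s$, $e_se_t=e_t$, $e_te_t=p_1e_s+p_2e_t$. $\bullet$ $\mathbb A^3_{1,2,3}$: unit $e=e_1+e_2+e_3$, $e_ie_i=e_i$ and $e_ie_j=0$ for $i\ne j$. *)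

theory Defs
  imports "HOL-Analysis.Analysis"
begin

section \<open>Algebras on \<open>\<real>\<^sup>3\<close>\<close>

text \<open>The carrier is \<open>real^3\<close>, whose index type has the elements \<open>1, 2, 3\<close> (with \<open>3 = 0\<close>);
  the canonical basis vector \<open>e\<^sub>i\<close> is \<open>axis i 1\<close>.\<close>

abbreviation bas :: "3 \<Rightarrow> real^3" where
  "bas i \<equiv> axis i 1"

definition R3_algebra :: "(real^3 \<Rightarrow> real^3 \<Rightarrow> real^3) \<Rightarrow> real^3 \<Rightarrow> bool" where
  "R3_algebra m e \<longleftrightarrow>
     bilinear m \<and>
     (\<forall>x y z. m (m x y) z = m x (m y z)) \<and>
     (\<forall>x y. m x y = m y x) \<and>
     (\<forall>x. m e x = x)"

definition struct_const :: "(real^3 \<Rightarrow> real^3 \<Rightarrow> real^3) \<Rightarrow> 3 \<Rightarrow> 3 \<Rightarrow> 3 \<Rightarrow> real" where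
  "struct_const m i j k = m (bas i) (bas j) $ k"

definition alg_units :: "(real^3 \<Rightarrow> real^3 \<Rightarrow> real^3) \<Rightarrow> real^3 \<Rightarrow> (real^3) set" where
  "alg_units m e = {a. \<exists>b. m a b = e}"

definition alg_inverse :: "(real^3 \<Rightarrow> real^3 \<Rightarrow> real^3) \<Rightarrow> real^3 \<Rightarrow> real^3 \<Rightarrow> real^3" where
  "alg_inverse m e a = (THE b. m a b = e)"

subsection \<open>The three families\<close>

definition is_A3_r ::
  "(real^3 \<Rightarrow> real^3 \<Rightarrow> real^3) \<Rightarrow> real^3 \<Rightarrow> 3 \<Rightarrow> 3 \<Rightarrow> 3
    \<Rightarrow> real \<Rightarrow> real \<Rightarrow> real \<Rightarrow> real \<Rightarrow> real \<Rightarrow> real \<Rightarrow> bool" where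
  "is_A3_r m e r s t p1 p2 p3 p4 p5 p6 \<longleftrightarrow>
     R3_algebra m e \<and> e = bas r \<and>
     (let p7 = p2 * p3 + p4\<^sup>2 - p1 * p4 - p2 * p6;
          p8 = p2 * p5 - p3 * p4;
          p9 = p3\<^sup>2 + p4 * p5 - p1 * p5 - p3 * p6
      in m (bas s) (bas s) = p7 *\<^sub>R bas r + p1 *\<^sub>R bas s + p2 *\<^sub>R bas t \<and>
         m (bas s) (bas t) = p8 *\<^sub>R bas r + p3 *\<^sub>R bas s + p4 *\<^sub>R bas t \<and>
         m (bas t) (bas t) = p9 *\<^sub>R bas r + p5 *\<^sub>R bas s + p6 *\<^sub>R bas t)"

definition is_A3_rs ::
  "(real^3 \<Rightarrow> real^3 \<Rightarrow> real^3) \<Rightarrow> real^3 \<Rightarrow> 3 \<Rightarrow> 3 \<Rightarrow> 3 \<Rightarrow> real \<Rightarrow> real \<Rightarrow> bool" where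
  "is_A3_rs m e r s t p1 p2 \<longleftrightarrow>
     R3_algebra m e \<and> e = bas r + bas s \<and>
     m (bas r) (bas r) = bas r \<and> m (bas r) (bas s) = 0 \<and> m (bas r) (bas t) = 0 \<and>
     m (bas s) (bas s) = bas s \<and> m (bas s) (bas t) = bas t \<and>
     m (bas t) (bas t) = p1 *\<^sub>R bas s + p2 *\<^sub>R bas t"

definition is_A3_123 :: "(real^3 \<Rightarrow> real^3 \<Rightarrow> real^3) \<Rightarrow> real^3 \<Rightarrow> bool" where
  "is_A3_123 m e \<longleftrightarrow>
     R3_algebra m e \<and> e = bas 1 + bas 2 + bas 3 \<and>
     (\<forall>i. m (bas i) (bas i) = bas i) \<and>
     (\<forall>i j. i \<noteq> j \<longrightarrow> m (bas i) (bas j) = 0)"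

section \<open>Algebrizable functions\<close>

text \<open>The Frechet derivative at \<open>w\<close> is multiplication by \<open>F' w\<close>. Functions on an open set are total
  functions of which only the values on that set matter.\<close>

definition has_alg_derivative_on ::
  "(real^3 \<Rightarrow> real^3 \<Rightarrow> real^3) \<Rightarrow> (real^3 \<Rightarrow> real^3) \<Rightarrow> (real^3 \<Rightarrow> real^3) \<Rightarrow> (real^3) set \<Rightarrow> bool" where
  "has_alg_derivative_on m F F' \<Omega> \<longleftrightarrow> (\<forall>w\<in>\<Omega>. (F has_derivative (\<lambda>\<xi>. m (F' w) \<xi>)) (at w))"

definition algebrizable_on ::
  "(real^3 \<Rightarrow> real^3 \<Rightarrow> real^3) \<Rightarrow> (real^3 \<Rightarrow> real^3) \<Rightarrow> (real^3) set \<Rightarrow> bool" where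
  "algebrizable_on m F \<Omega> \<longleftrightarrow> (\<exists>F'. has_alg_derivative_on m F F' \<Omega>)"

definition alg_antiderivative_on ::
  "(real^3 \<Rightarrow> real^3 \<Rightarrow> real^3) \<Rightarrow> (real^3 \<Rightarrow> real^3) \<Rightarrow> (real^3 \<Rightarrow> real^3) \<Rightarrow> (real^3) set \<Rightarrow> bool" where
  "alg_antiderivative_on m H K N \<longleftrightarrow> has_alg_derivative_on m H K N"

text \<open>\<open>\<Omega>(F, A\<^sup>*)\<close>, the function \<open>e/F\<close> on it, and the fields \<open>G\<^sub>k\<close>.\<close>

definition unit_domain ::
  "(real^3 \<Rightarrow> real^3 \<Rightarrow> real^3) \<Rightarrow> real^3 \<Rightarrow> (real^3 \<Rightarrow> real^3) \<Rightarrow> (real^3) set \<Rightarrow> (real^3) set" where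
  "unit_domain m e F \<Omega> = {w \<in> \<Omega>. F w \<in> alg_units m e}"

definition reciprocal ::
  "(real^3 \<Rightarrow> real^3 \<Rightarrow> real^3) \<Rightarrow> real^3 \<Rightarrow> (real^3 \<Rightarrow> real^3) \<Rightarrow> real^3 \<Rightarrow> real^3" where
  "reciprocal m e F w = alg_inverse m e (F w)"

definition G_field ::
  "(real^3 \<Rightarrow> real^3 \<Rightarrow> real^3) \<Rightarrow> real^3 \<Rightarrow> (real^3 \<Rightarrow> real^3) \<Rightarrow> 3 \<Rightarrow> real^3 \<Rightarrow> real^3" where
  "G_field m e F k w =
     (\<Sum>j\<in>UNIV. \<Sum>i\<in>UNIV. (struct_const m i j k * reciprocal m e F w $ i) *\<^sub>R bas j)"

section \<open>Line integrals\<close>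

text \<open>A \<open>valid_path\<close> is a continuous, piecewise continuously differentiable curve on \<open>[0,1]\<close>.\<close>

definition curves :: "(real^3) set \<Rightarrow> real^3 \<Rightarrow> real^3 \<Rightarrow> (real \<Rightarrow> real^3) set" where
  "curves N a b = {\<gamma>. valid_path \<gamma> \<and> path_image \<gamma> \<subseteq> N \<and> pathstart \<gamma> = a \<and> pathfinish \<gamma> = b}"

definition has_line_integral :: "(real^3 \<Rightarrow> real^3) \<Rightarrow> real \<Rightarrow> (real \<Rightarrow> real^3) \<Rightarrow> bool" where
  "has_line_integral G I \<gamma> \<longleftrightarrow>
     ((\<lambda>t. G (\<gamma> t) \<bullet> vector_derivative \<gamma> (at t within {0..1})) has_integral I) {0..1}"

definition line_integral :: "(real^3 \<Rightarrow> real^3) \<Rightarrow> (real \<Rightarrow> real^3) \<Rightarrow> real" where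
  "line_integral G \<gamma> =
     integral {0..1} (\<lambda>t. G (\<gamma> t) \<bullet> vector_derivative \<gamma> (at t within {0..1}))"

section \<open>First integrals and transversality\<close>

definition first_integral_on ::
  "(real^3) set \<Rightarrow> (real^3 \<Rightarrow> real^3) \<Rightarrow> (real^3 \<Rightarrow> real) \<Rightarrow> bool" where
  "first_integral_on N F h \<longleftrightarrow> (\<forall>w\<in>N. \<exists>D. GDERIV h w :> D \<and> D \<bullet> F w = 0)"

definition C1_map_on :: "(real^3) set \<Rightarrow> (real^3 \<Rightarrow> real^3) \<Rightarrow> bool" where
  "C1_map_on U f \<longleftrightarrow>
     (\<exists>f' :: real^3 \<Rightarrow> ((real^3) \<Rightarrow>\<^sub>L (real^3)).
        (\<forall>x\<in>U. (f has_derivative blinfun_apply (f' x)) (at x)) \<and> continuous_on U f')"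

text \<open>An embedded \<open>C\<^sup>1\<close> surface: locally the image of a coordinate plane under a
  \<open>C\<^sup>1\<close> diffeomorphism of open subsets of \<open>\<real>\<^sup>3\<close>.\<close>

definition C1_surface :: "(real^3) set \<Rightarrow> bool" where
  "C1_surface S \<longleftrightarrow>
     (\<forall>p\<in>S. \<exists>U V \<phi> \<psi>. open U \<and> open V \<and> p \<in> U \<and> homeomorphism U V \<phi> \<psi> \<and>
        C1_map_on U \<phi> \<and> C1_map_on V \<psi> \<and> \<phi> ` (S \<inter> U) = {y \<in> V. y $ 3 = 0})"

text \<open>Tangent vectors are the velocities of curves in \<open>S\<close> through \<open>p\<close>; for a \<open>C\<^sup>1\<close> surface they
  form the tangent plane.\<close>

definition tangent_space :: "(real^3) set \<Rightarrow> real^3 \<Rightarrow> (real^3) set" where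
  "tangent_space S p =
     {v. \<exists>\<gamma> \<epsilon>. \<epsilon> > 0 \<and> \<gamma> 0 = p \<and> (\<forall>t. \<bar>t\<bar> < \<epsilon> \<longrightarrow> \<gamma> t \<in> S) \<and> (\<gamma> has_vector_derivative v) (at (0::real))}"

definition intersect_transversally :: "(real^3) set \<Rightarrow> (real^3) set \<Rightarrow> bool" where
  "intersect_transversally S T \<longleftrightarrow>
     (\<forall>p\<in>S \<inter> T. {u + v | u v. u \<in> tangent_space S p \<and> v \<in> tangent_space T p} = UNIV)"

definition level_set :: "(real^3) set \<Rightarrow> (real^3 \<Rightarrow> real) \<Rightarrow> real \<Rightarrow> (real^3) set" where
  "level_set N h c = {w \<in> N. h w = c}"

text \<open>That the level sets are surfaces is part of the requirement: without it a function with
  vanishing gradient would be transversal to everything.\<close>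

definition transversal_intersections ::
  "(real^3) set \<Rightarrow> (real^3 \<Rightarrow> real) \<Rightarrow> (real^3 \<Rightarrow> real) \<Rightarrow> bool" where
  "transversal_intersections N h k \<longleftrightarrow>
     (\<forall>c1 c2. level_set N h c1 \<inter> level_set N k c2 \<noteq> {} \<longrightarrow>
        C1_surface (level_set N h c1) \<and> C1_surface (level_set N k c2) \<and>
        intersect_transversally (level_set N h c1) (level_set N k c2))"

definition transversal_first_integrals ::
  "(real^3) set \<Rightarrow> (real^3 \<Rightarrow> real^3) \<Rightarrow> (real^3 \<Rightarrow> real) \<Rightarrow> (real^3 \<Rightarrow> real) \<Rightarrow> bool" where
  "transversal_first_integrals N F h k \<longleftrightarrow>
     first_integral_on N F h \<and> first_integral_on N F k \<and> transversal_intersections N h k"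

end

theory Submission imports Defs begin

text \<open>Let \<open>K = e/F\<close>. A function \<open>H\<close> has \<open>K\<close> as its derivative in the algebra exactly if the \<open>k\<close>-th
  component of \<open>H\<close> has the derivative \<open>\<xi> \<mapsto> (K w \<xi>)\<^sub>k\<close>, and the structure constants are arranged
  in \<open>G\<^sub>k\<close> such that this number is \<open>G\<^sub>k w \<bullet> \<xi>\<close>. So the \<open>H\<close> in question are the maps whose components are
  potentials of \<open>G\<^sub>1, G\<^sub>2, G\<^sub>3\<close>, and the first part of the proposition says that such potentials exist on \<open>N\<close>
  and are given by line integrals.

  Like \<open>F\<close>, the function \<open>K\<close> is differentiable in the algebra (\<open>has_derivative_alg_inverse\<close>), and
  commutativity and associativity make the derivative of each \<open>G\<^sub>k\<close> a self-adjoint map: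
  \<open>(K' u) v = (K' v) u\<close>. So \<open>G\<^sub>k\<close> is closed, but its derivative need not be continuous, and the usual
  proof of the Poincare lemma by differentiation under the integral sign is unavailable. The argument of
  Goursat works instead: the integral over a triangle is approximated, near a point, by that of the
  affine part of the field, which is a gradient, and bisection makes the error negligible
  (\<open>tri_integral_closed_field_zero\<close>). Hence the integrals over segments add up like
  differences of a function inside every ball contained in \<open>N\<close>.

  The passage from balls to \<open>N\<close> uses no analysis. A function \<open>D\<close> of two points with
  \<open>D a b + D b c = D a c\<close> near every point can be integrated along continuous paths, and also over
  continuous images of a square, by gluing over a fine division. On a square given by a homotopy the two
  sides belonging to the fixed end points are mapped to constants, so homotopic paths give the same result;
  on a simply connected set this yields a function whose differences are locally \<open>D\<close>
  (\<open>local_cocycle_imp_coboundary\<close>). Together these results give \<open>closed_field_has_potential\<close>.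

  For the second part, the position of the unit is decisive: in each of the three families both functions have the form \<open>w \<mapsto> a \<bullet> H w\<close> with \<open>a \<bullet> e = 0\<close>, and the derivative of this
  function in the direction \<open>F w\<close> is \<open>a \<bullet> (K w F w) = a \<bullet> e = 0\<close>. The derivative of \<open>H\<close> at \<open>w\<close> is
  multiplication by the unit \<open>K w\<close>, so \<open>H\<close> is a local \<open>C\<^sup>1\<close> diffeomorphism that carries the level
  sets of \<open>a \<bullet> H\<close> and \<open>b \<bullet> H\<close> into planes orthogonal to \<open>a\<close> and \<open>b\<close>; transversality is then the
  linear independence of \<open>a\<close> and \<open>b\<close>.\<close>

section \<open>Local cocycles on simply connected sets\<close>

text \<open>The local form of path independence. For the integrals of a field over segments it says that the
  integrals over small triangles vanish.\<close>
definition local_cocycle :: "'a::topological_space set \<Rightarrow> ('a \<Rightarrow> 'a \<Rightarrow> 'b::ab_group_add) \<Rightarrow> bool" where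
  "local_cocycle N D \<longleftrightarrow>
     (\<forall>x\<in>N. \<exists>U. open U \<and> x \<in> U \<and> (\<forall>a\<in>U. \<forall>b\<in>U. \<forall>c\<in>U. D a b + D b c = D a c))"

text \<open>The pullback of \<open>D\<close> under \<open>h\<close> is, near each point of \<open>A\<close>, the difference of values of \<open>\<phi>\<close>. Relative
  to a map \<open>h\<close> such a \<open>\<phi>\<close> can exist even where \<open>D\<close> itself is not a difference of values on the image,
  as for a path that winds around a hole.\<close>
definition potential_along ::
  "('a \<Rightarrow> 'a \<Rightarrow> 'b::ab_group_add) \<Rightarrow> ('c::topological_space \<Rightarrow> 'a) \<Rightarrow> 'c set \<Rightarrow> ('c \<Rightarrow> 'b) \<Rightarrow> bool" where
  "potential_along D h A \<phi> \<longleftrightarrow>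
     (\<forall>z\<in>A. \<exists>W. open W \<and> z \<in> W \<and> (\<forall>x\<in>A \<inter> W. \<forall>y\<in>A \<inter> W. \<phi> y - \<phi> x = D (h x) (h y)))"

lemma local_cocycleE:
  assumes "local_cocycle N D" "x \<in> N"
  obtains U where "open U" "x \<in> U" "\<And>a b c. \<lbrakk>a \<in> U; b \<in> U; c \<in> U\<rbrakk> \<Longrightarrow> D a b + D b c = D a c"
proof -
  obtain U where U: "open U \<and> x \<in> U \<and> (\<forall>a\<in>U. \<forall>b\<in>U. \<forall>c\<in>U. D a b + D b c = D a c)"
    using bspec[OF assms(1)[unfolded local_cocycle_def] assms(2)] ..
  show thesis by (rule that[of U]) (use U in auto)
qed

lemma potential_alongE:
  assumes "potential_along D h A \<phi>" "z \<in> A"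
  obtains W where "open W" "z \<in> W" "\<And>x y. \<lbrakk>x \<in> A \<inter> W; y \<in> A \<inter> W\<rbrakk> \<Longrightarrow> \<phi> y - \<phi> x = D (h x) (h y)"
proof -
  obtain W where W: "open W \<and> z \<in> W \<and> (\<forall>x\<in>A \<inter> W. \<forall>y\<in>A \<inter> W. \<phi> y - \<phi> x = D (h x) (h y))"
    using bspec[OF assms(1)[unfolded potential_along_def] assms(2)] ..
  show thesis by (rule that[of W]) (use W in auto)
qed

lemma potential_alongI:
  assumes "\<And>z. z \<in> A \<Longrightarrow> \<exists>W. open W \<and> z \<in> W \<and> (\<forall>x\<in>A \<inter> W. \<forall>y\<in>A \<inter> W. \<phi> y - \<phi> x = D (h x) (h y))"
  shows "potential_along D h A \<phi>"
  using assms unfolding potential_along_def by (rule ballI)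

lemma local_cocycle_refl:
  assumes "local_cocycle N D" "x \<in> N"
  shows "D x x = 0"
proof -
  obtain U where U: "open U" "x \<in> U" "\<And>a b c. \<lbrakk>a \<in> U; b \<in> U; c \<in> U\<rbrakk> \<Longrightarrow> D a b + D b c = D a c"
    using local_cocycleE[OF assms] by metis
  have "D x x + D x x = D x x" by (rule U(3)) (rule U(2))+
  then show ?thesis by simp
qed

lemma local_cocycle_pullback:
  assumes D: "local_cocycle N D" and h: "continuous_on A h" "h ` A \<subseteq> N" and z: "z \<in> A"
  obtains W where "open W" "z \<in> W"
    "\<And>x y w. \<lbrakk>x \<in> A \<inter> W; y \<in> A \<inter> W; w \<in> A \<inter> W\<rbrakk> \<Longrightarrow> D (h x) (h y) + D (h y) (h w) = D (h x) (h w)"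
proof -
  have "h z \<in> N" using h z by auto
  then obtain U where U: "open U" "h z \<in> U" "\<And>a b c. \<lbrakk>a \<in> U; b \<in> U; c \<in> U\<rbrakk> \<Longrightarrow> D a b + D b c = D a c"
    using local_cocycleE[OF D] by metis
  obtain W where W: "open W" "W \<inter> A = h -` U \<inter> A"
    using h(1) U(1) unfolding continuous_on_open_invariant by meson
  show thesis
  proof
    show "open W" "z \<in> W" using W U z by auto
    show "D (h x) (h y) + D (h y) (h w) = D (h x) (h w)"
      if "x \<in> A \<inter> W" "y \<in> A \<inter> W" "w \<in> A \<inter> W" for x y w
      by (rule U(3)) (use that W in blast)+
  qed
qed

lemma potential_along_subset:
  assumes "potential_along D h A \<phi>" "B \<subseteq> A"
  shows "potential_along D h B \<phi>"
proof (rule potential_alongI)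
  fix z assume "z \<in> B"
  then have "z \<in> A" using assms(2) by blast
  then obtain W where W: "open W" "z \<in> W" "\<And>x y. \<lbrakk>x \<in> A \<inter> W; y \<in> A \<inter> W\<rbrakk> \<Longrightarrow> \<phi> y - \<phi> x = D (h x) (h y)"
    using potential_alongE[OF assms(1)] by metis
  show "\<exists>W. open W \<and> z \<in> W \<and> (\<forall>x\<in>B \<inter> W. \<forall>y\<in>B \<inter> W. \<phi> y - \<phi> x = D (h x) (h y))"
    by (intro exI[of _ W] conjI W(1,2) ballI W(3)) (use assms(2) in blast)+
qed

lemma potential_along_cong:
  assumes "potential_along D h A \<phi>" and "\<And>z. z \<in> A \<Longrightarrow> g z = h z" and "\<And>z. z \<in> A \<Longrightarrow> \<psi> z = \<phi> z"
  shows "potential_along D g A \<psi>"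
proof (rule potential_alongI)
  fix z assume "z \<in> A"
  then obtain W where W: "open W" "z \<in> W" "\<And>x y. \<lbrakk>x \<in> A \<inter> W; y \<in> A \<inter> W\<rbrakk> \<Longrightarrow> \<phi> y - \<phi> x = D (h x) (h y)"
    using potential_alongE[OF assms(1)] by metis
  show "\<exists>W. open W \<and> z \<in> W \<and> (\<forall>x\<in>A \<inter> W. \<forall>y\<in>A \<inter> W. \<psi> y - \<psi> x = D (g x) (g y))"
    using W by (intro exI[of _ W]) (simp add: assms(2,3))
qed

lemma potential_along_add_const:
  "potential_along D h A \<phi> \<Longrightarrow> potential_along D h A (\<lambda>z. \<phi> z + c)"
  unfolding potential_along_def by simp

lemma potential_along_compose:
  assumes \<phi>: "potential_along D h A \<phi>" and r: "continuous_on B r" "r ` B \<subseteq> A"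
  shows "potential_along D (h \<circ> r) B (\<phi> \<circ> r)"
proof (rule potential_alongI)
  fix z assume z: "z \<in> B"
  then have "r z \<in> A" using r(2) by blast
  then obtain W where W: "open W" "r z \<in> W" "\<And>x y. \<lbrakk>x \<in> A \<inter> W; y \<in> A \<inter> W\<rbrakk> \<Longrightarrow> \<phi> y - \<phi> x = D (h x) (h y)"
    using potential_alongE[OF \<phi>] by metis
  obtain V where V: "open V" "V \<inter> B = r -` W \<inter> B"
    using r(1) W(1) unfolding continuous_on_open_invariant by meson
  have r_in: "r x \<in> A \<inter> W" if "x \<in> B \<inter> V" for x using V r(2) that by blast
  have "z \<in> V" using V z W(2) by blast
  then show "\<exists>V. open V \<and> z \<in> V \<and> (\<forall>x\<in>B \<inter> V. \<forall>y\<in>B \<inter> V. (\<phi> \<circ> r) y - (\<phi> \<circ> r) x = D ((h \<circ> r) x) ((h \<circ> r) y))"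
    unfolding o_def by (intro exI[of _ V] conjI V(1) ballI W(3) r_in)
qed

text \<open>Two potentials along the same map differ by a locally constant function.\<close>
lemma potential_along_unique:
  assumes A: "connected A" and \<phi>: "potential_along D h A \<phi>" and \<psi>: "potential_along D h A \<psi>"
    and xy: "x \<in> A" "y \<in> A"
  shows "\<phi> y - \<phi> x = \<psi> y - \<psi> x"
proof -
  have "(\<lambda>z. \<phi> z - \<psi> z) constant_on A"
  proof (rule locally_constant_imp_constant[OF A])
    fix a assume a: "a \<in> A"
    obtain V where V: "open V" "a \<in> V" "\<And>x y. \<lbrakk>x \<in> A \<inter> V; y \<in> A \<inter> V\<rbrakk> \<Longrightarrow> \<phi> y - \<phi> x = D (h x) (h y)"
      using potential_alongE[OF \<phi> a] by metis
    obtain W where W: "open W" "a \<in> W" "\<And>x y. \<lbrakk>x \<in> A \<inter> W; y \<in> A \<inter> W\<rbrakk> \<Longrightarrow> \<psi> y - \<psi> x = D (h x) (h y)"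
      using potential_alongE[OF \<psi> a] by metis
    have *: "\<phi> x - \<psi> x = \<phi> a - \<psi> a" if "x \<in> A \<inter> (V \<inter> W)" for x
    proof -
      have "\<phi> x - \<phi> a = \<psi> x - \<psi> a" using V(3)[of a x] W(3)[of a x] V(2) W(2) that a by simp
      then show ?thesis by (simp add: algebra_simps)
    qed
    show "\<exists>T. openin (top_of_set A) T \<and> a \<in> T \<and> (\<forall>x\<in>T. \<phi> x - \<psi> x = \<phi> a - \<psi> a)"
      by (intro exI[of _ "A \<inter> (V \<inter> W)"] conjI ballI * openin_open_Int open_Int V(1) W(1))
         (use V(2) W(2) a in auto)
  qed
  then have "\<phi> x - \<psi> x = \<phi> y - \<psi> y" using xy unfolding constant_on_def by metis
  then show ?thesis by (simp add: algebra_simps)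
qed

text \<open>Along a constant map the zero function is a potential, because \<open>D p p = 0\<close>.\<close>
lemma potential_along_const:
  assumes "connected A" "local_cocycle N D" "p \<in> N" "potential_along D (\<lambda>_. p) A \<phi>" "x \<in> A" "y \<in> A"
  shows "\<phi> y = \<phi> x"
proof -
  have "potential_along D (\<lambda>_. p) A (\<lambda>_. 0)"
    by (rule potential_alongI, rule exI[of _ UNIV]) (simp add: local_cocycle_refl[OF assms(2,3)])
  from potential_along_unique[OF assms(1,4) this assms(5,6)] show ?thesis by simp
qed

text \<open>Only a point of \<open>A \<inter> B\<close> has points of both sets nearby, and there the difference between
  \<open>x \<in> A\<close> and \<open>y \<in> B\<close> is computed through that point by the cocycle identity.\<close>
lemma potential_along_Un:
  assumes D: "local_cocycle N D" and h: "continuous_on (A \<union> B) h" "h ` (A \<union> B) \<subseteq> N"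
    and AB: "closed A" "closed B" and \<phi>: "potential_along D h A \<phi>" "potential_along D h B \<phi>"
  shows "potential_along D h (A \<union> B) \<phi>"
proof (rule potential_alongI)
  fix z assume z: "z \<in> A \<union> B"
  consider "z \<in> A \<inter> B" | "z \<in> A - B" | "z \<in> B - A" using z by blast
  then show "\<exists>W. open W \<and> z \<in> W \<and>
      (\<forall>x\<in>(A \<union> B) \<inter> W. \<forall>y\<in>(A \<union> B) \<inter> W. \<phi> y - \<phi> x = D (h x) (h y))"
  proof cases
    case 1
    obtain V where V: "open V" "z \<in> V"
      "\<And>x y w. \<lbrakk>x \<in> (A \<union> B) \<inter> V; y \<in> (A \<union> B) \<inter> V; w \<in> (A \<union> B) \<inter> V\<rbrakk>
         \<Longrightarrow> D (h x) (h y) + D (h y) (h w) = D (h x) (h w)"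
      using local_cocycle_pullback[OF D h z] by metis
    obtain WA where WA: "open WA" "z \<in> WA" "\<And>x y. \<lbrakk>x \<in> A \<inter> WA; y \<in> A \<inter> WA\<rbrakk> \<Longrightarrow> \<phi> y - \<phi> x = D (h x) (h y)"
      using potential_alongE[OF \<phi>(1), of z] 1 by blast
    obtain WB where WB: "open WB" "z \<in> WB" "\<And>x y. \<lbrakk>x \<in> B \<inter> WB; y \<in> B \<inter> WB\<rbrakk> \<Longrightarrow> \<phi> y - \<phi> x = D (h x) (h y)"
      using potential_alongE[OF \<phi>(2), of z] 1 by blast
    let ?W = "V \<inter> WA \<inter> WB"
    have z_in: "z \<in> A \<inter> WA" "z \<in> B \<inter> WB" using 1 WA(2) WB(2) by auto
    have *: "\<phi> y - \<phi> x = D (h x) (h y)" if "x \<in> (A \<union> B) \<inter> ?W" "y \<in> (A \<union> B) \<inter> ?W" for x y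
    proof -
      have "x \<in> A \<inter> WA \<or> x \<in> B \<inter> WB" "y \<in> A \<inter> WA \<or> y \<in> B \<inter> WB" using that by auto
      then have "\<phi> z - \<phi> x = D (h x) (h z)" "\<phi> y - \<phi> z = D (h z) (h y)"
        using WA(3) WB(3) z_in by blast+
      moreover have "D (h x) (h z) + D (h z) (h y) = D (h x) (h y)"
        using V(2) z that by (intro V(3)) auto
      ultimately show ?thesis by (simp add: algebra_simps) 
    qed
    show ?thesis using V(1,2) WA(1,2) WB(1,2) by (intro exI[of _ ?W] conjI ballI *) auto
  next
    case 2
    obtain W where W: "open W" "z \<in> W" "\<And>x y. \<lbrakk>x \<in> A \<inter> W; y \<in> A \<inter> W\<rbrakk> \<Longrightarrow> \<phi> y - \<phi> x = D (h x) (h y)"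
      using potential_alongE[OF \<phi>(1), of z] 2 by blast
    show ?thesis
      by (intro exI[of _ "W - B"] conjI ballI W(3) open_Diff W(1) AB) (use 2 W(2) in auto)
  next
    case 3
    obtain W where W: "open W" "z \<in> W" "\<And>x y. \<lbrakk>x \<in> B \<inter> W; y \<in> B \<inter> W\<rbrakk> \<Longrightarrow> \<phi> y - \<phi> x = D (h x) (h y)"
      using potential_alongE[OF \<phi>(2), of z] 3 by blast
    show ?thesis
      by (intro exI[of _ "W - A"] conjI ballI W(3) open_Diff W(1) AB) (use 3 W(2) in auto)
  qed
qed

text \<open>On the connected overlap the two potentials differ by a constant, which can be subtracted.\<close>
lemma potential_along_glue:
  assumes D: "local_cocycle N D" and h: "continuous_on (A \<union> B) h" "h ` (A \<union> B) \<subseteq> N"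
    and AB: "closed A" "closed B" "connected (A \<inter> B)"
    and \<phi>: "potential_along D h A \<phi>" and \<psi>: "potential_along D h B \<psi>"
  shows "\<exists>\<theta>. potential_along D h (A \<union> B) \<theta>"
proof -
  obtain c where c: "\<And>z. z \<in> A \<inter> B \<Longrightarrow> \<phi> z = \<psi> z + c"
  proof (cases "A \<inter> B = {}")
    case False
    then obtain z0 where z0: "z0 \<in> A \<inter> B" by blast
    have "\<phi> z = \<psi> z + (\<phi> z0 - \<psi> z0)" if "z \<in> A \<inter> B" for z
    proof -
      have "\<phi> z - \<phi> z0 = \<psi> z - \<psi> z0"
        using potential_along_unique[OF AB(3) potential_along_subset[OF \<phi>] potential_along_subset[OF \<psi>] z0 that]
        by auto
      then show ?thesis by (simp add: algebra_simps)
    qed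
    then show thesis by (rule that)
  qed (use that in blast)
  let ?\<theta> = "\<lambda>z. if z \<in> A then \<phi> z else \<psi> z + c"
  have "potential_along D h A ?\<theta>"
    by (rule potential_along_cong[OF \<phi>]) auto
  moreover have "potential_along D h B ?\<theta>"
    by (rule potential_along_cong[OF potential_along_add_const[OF \<psi>, of c]]) (auto simp: c)
  ultimately show ?thesis using potential_along_Un[OF D h AB(1,2)] by blast
qed

text \<open>The potential with base point \<open>p\<close>, available where the cocycle identity holds without localization.\<close>
lemma potential_along_star:
  assumes "\<And>x y. \<lbrakk>x \<in> A; y \<in> A\<rbrakk> \<Longrightarrow> D p (h x) + D (h x) (h y) = D p (h y)"
  shows "potential_along D h A (\<lambda>x. D p (h x))"
proof (rule potential_alongI)
  fix z assume z: "z \<in> A"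
  have "D p (h y) - D p (h x) = D (h x) (h y)" if "x \<in> A" "y \<in> A" for x y
    using assms[OF that] by (metis add_diff_cancel_left')
  then show "\<exists>W. open W \<and> z \<in> W \<and> (\<forall>x\<in>A \<inter> W. \<forall>y\<in>A \<inter> W. D p (h y) - D p (h x) = D (h x) (h y))"
    by (intro exI[of _ UNIV]) auto
qed

text \<open>A nondegenerate box is the closure of its interior. So if a hyperplane cuts off a part
  with empty interior, the box lies entirely on the other side.\<close>
lemma cbox_halfspace_trivial:
  fixes c d k :: "'c::euclidean_space"
  assumes ne: "interior (cbox c d) \<noteq> {}"
  shows "interior (cbox c d \<inter> {x. x \<bullet> k \<le> s}) = {} \<Longrightarrow> cbox c d \<inter> {x. x \<bullet> k \<ge> s} = cbox c d"
    and "interior (cbox c d \<inter> {x. x \<bullet> k \<ge> s}) = {} \<Longrightarrow> cbox c d \<inter> {x. x \<bullet> k \<le> s} = cbox c d"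
proof -
  have cl: "closure (box c d) = cbox c d" using ne by (simp add: interior_cbox)
  have "cbox c d \<subseteq> {x. x \<bullet> k \<ge> s}" if "interior (cbox c d \<inter> {x. x \<bullet> k \<le> s}) = {}"
    unfolding cl[symmetric]
  proof (rule closure_minimal)
    have "box c d \<inter> {x. x \<bullet> k < s} \<subseteq> interior (cbox c d \<inter> {x. x \<bullet> k \<le> s})"
    proof (rule interior_maximal)
      show "open (box c d \<inter> {x. x \<bullet> k < s})"
        using open_halfspace_lt[of k s] by (simp add: open_Int open_box inner_commute)
    qed (use box_subset_cbox[of c d] in auto)
    then show "box c d \<subseteq> {x. x \<bullet> k \<ge> s}" using that by force
  qed (use closed_halfspace_ge[of s k] in \<open>simp add: inner_commute\<close>)
  then show "interior (cbox c d \<inter> {x. x \<bullet> k \<le> s}) = {} \<Longrightarrow> cbox c d \<inter> {x. x \<bullet> k \<ge> s} = cbox c d" by blast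
  have "cbox c d \<subseteq> {x. x \<bullet> k \<le> s}" if "interior (cbox c d \<inter> {x. x \<bullet> k \<ge> s}) = {}"
    unfolding cl[symmetric]
  proof (rule closure_minimal)
    have "box c d \<inter> {x. x \<bullet> k > s} \<subseteq> interior (cbox c d \<inter> {x. x \<bullet> k \<ge> s})"
    proof (rule interior_maximal)
      show "open (box c d \<inter> {x. x \<bullet> k > s})"
        using open_halfspace_gt[of s k] by (simp add: open_Int open_box inner_commute)
    qed (use box_subset_cbox[of c d] in auto)
    then show "box c d \<subseteq> {x. x \<bullet> k \<le> s}" using that by force
  qed (use closed_halfspace_le[of k s] in \<open>simp add: inner_commute\<close>)
  then show "interior (cbox c d \<inter> {x. x \<bullet> k \<ge> s}) = {} \<Longrightarrow> cbox c d \<inter> {x. x \<bullet> k \<le> s} = cbox c d" by blast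
qed

text \<open>The set function "there is a potential on this box" is additive under cutting boxes by
  hyperplanes, since the two halves meet in a convex set and \<open>potential_along_glue\<close> applies. It
  therefore suffices to look at the pieces of a division so fine that the cocycle identity holds on each.\<close>
lemma potential_along_cbox_exists:
  fixes h :: "'c::euclidean_space \<Rightarrow> 'a::topological_space"
  assumes D: "local_cocycle N D" and h: "continuous_on (cbox a b) h" "h ` cbox a b \<subseteq> N"
    and ne: "box a b \<noteq> {}"
  shows "\<exists>\<phi>. potential_along D h (cbox a b) \<phi>"
proof -
  \<comment> \<open>Additive set functions must be neutral on degenerate boxes, and boxes need not lie in
      the domain of \<open>h\<close>; hence the first alternative and the intersection.\<close>
  define good where "good K \<longleftrightarrow> interior K = {} \<or> (\<exists>\<phi>. potential_along D h (K \<inter> cbox a b) \<phi>)" for K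
  have good_subset: "good L" if "good K" "L \<subseteq> K" for K L
    using that interior_mono[OF that(2)] potential_along_subset[of D h "K \<inter> cbox a b" _ "L \<inter> cbox a b"]
    unfolding good_def by fast
  interpret operative "(\<and>)" True good
  proof
    show "good (cbox c d) = True" if "box c d = {}" for c d
      using that by (simp add: good_def interior_cbox)
    fix c d k :: 'c and s :: real
    assume k: "k \<in> Basis"
    let ?L = "cbox c d \<inter> {x. x \<bullet> k \<le> s}" and ?R = "cbox c d \<inter> {x. x \<bullet> k \<ge> s}"
    have "good (cbox c d)" if L: "good ?L" and R: "good ?R"
    proof (cases "interior (cbox c d) = {} \<or> interior ?L = {} \<or> interior ?R = {}")
      case True
      then show ?thesis using L R cbox_halfspace_trivial[where c = c and d = d and k = k and s = s] by (metis good_def)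
    next
      case False
      then obtain \<phi> \<psi> where "potential_along D h (?L \<inter> cbox a b) \<phi>" "potential_along D h (?R \<inter> cbox a b) \<psi>"
        using L R unfolding good_def by blast
      moreover have "continuous_on (?L \<inter> cbox a b \<union> ?R \<inter> cbox a b) h"
        by (rule continuous_on_subset[OF h(1)]) auto
      moreover have "h ` (?L \<inter> cbox a b \<union> ?R \<inter> cbox a b) \<subseteq> N" using h(2) by auto
      moreover have "closed (?L \<inter> cbox a b)" "closed (?R \<inter> cbox a b)"
        using closed_halfspace_le[of k s] closed_halfspace_ge[of s k]
        by (intro closed_Int closed_cbox; simp add: inner_commute)+
      moreover have "connected (?L \<inter> cbox a b \<inter> (?R \<inter> cbox a b))"
        using convex_halfspace_le[where a = k and b = s] convex_halfspace_ge[where a = k and b = s]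
        by (intro convex_connected convex_Int convex_box) (simp_all add: inner_commute)
      ultimately have "\<exists>\<theta>. potential_along D h (?L \<inter> cbox a b \<union> ?R \<inter> cbox a b) \<theta>"
        by (intro potential_along_glue[OF D])
      moreover have "?L \<inter> cbox a b \<union> ?R \<inter> cbox a b = cbox c d \<inter> cbox a b" by auto
      ultimately show ?thesis unfolding good_def by simp
    qed
    then show "good (cbox c d) = (good ?L \<and> good ?R)"
      using good_subset by blast
  qed
  have "\<exists>W. open W \<and> z \<in> W \<and> (z \<in> cbox a b \<longrightarrow> (\<forall>x\<in>cbox a b \<inter> W. \<forall>y\<in>cbox a b \<inter> W.
          D (h z) (h x) + D (h x) (h y) = D (h z) (h y)))" for z
  proof (cases "z \<in> cbox a b")
    case True
    obtain W where "open W" "z \<in> W" "\<And>x y w. \<lbrakk>x \<in> cbox a b \<inter> W; y \<in> cbox a b \<inter> W; w \<in> cbox a b \<inter> W\<rbrakk>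
        \<Longrightarrow> D (h x) (h y) + D (h y) (h w) = D (h x) (h w)"
      using local_cocycle_pullback[OF D h True] by blast
    then show ?thesis using True by (intro exI[of _ W]) auto
  qed (use open_UNIV in blast)
  then obtain W where W: "\<And>z. open (W z)" "\<And>z. z \<in> W z"
    "\<And>z x y. \<lbrakk>z \<in> cbox a b; x \<in> cbox a b \<inter> W z; y \<in> cbox a b \<inter> W z\<rbrakk> \<Longrightarrow> D (h z) (h x) + D (h x) (h y) = D (h z) (h y)"
    by metis
  have "gauge W" using W by (simp add: gauge_def)
  then obtain p where p: "p tagged_division_of cbox a b" "W fine p"
    by (rule fine_division_exists)
  have "good K" if "(z, K) \<in> p" for z K
  proof -
    have "z \<in> cbox a b" "K \<subseteq> W z" using p that tagged_division_ofD(2,3)[OF p(1) that] by (auto simp: fine_def)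
    then have "potential_along D h (K \<inter> cbox a b) (\<lambda>x. D (h z) (h x))"
      by (intro potential_along_star W(3)) auto
    then show ?thesis unfolding good_def by blast
  qed
  then have "good (cbox a b)"
    unfolding tagged_division[OF p(1), symmetric] comm_monoid_set_F_and by auto
  then show ?thesis using ne by (simp add: good_def interior_cbox)
qed

text \<open>Take a potential on the square. Its restrictions to the edges traced by \<open>p\<close> and \<open>q\<close> have the
  increments of \<open>\<phi>\<close> and \<open>\<psi>\<close>; on the other two edges the homotopy is constant, so the increment is 0.\<close>
lemma potential_along_homotopic_paths:
  assumes D: "local_cocycle N D" and hom: "homotopic_paths N p q"
    and \<phi>: "potential_along D p {0..1} \<phi>" and \<psi>: "potential_along D q {0..1} \<psi>"
  shows "\<phi> 1 - \<phi> 0 = \<psi> 1 - \<psi> 0"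
proof -
  let ?I = "{0..1::real}"
  obtain h where h: "continuous_on (?I \<times> ?I) h" "h ` (?I \<times> ?I) \<subseteq> N"
    "\<And>x. x \<in> ?I \<Longrightarrow> h (0, x) = p x" "\<And>x. x \<in> ?I \<Longrightarrow> h (1, x) = q x"
    "\<And>t. t \<in> ?I \<Longrightarrow> h (t, 0) = p 0" "\<And>t. t \<in> ?I \<Longrightarrow> h (t, 1) = p 1"
    using hom unfolding homotopic_paths by (auto simp: pathstart_def pathfinish_def image_subset_iff_funcset)
  have box: "?I \<times> ?I = cbox (0, 0) (1, 1)" by (simp add: cbox_Pair_eq)
  have ne: "box (0::real, 0::real) (1, 1) \<noteq> {}" by (simp add: box_ne_empty Basis_prod_def)
  obtain \<theta> where \<theta>: "potential_along D h (?I \<times> ?I) \<theta>"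
    using potential_along_cbox_exists[OF D _ _ ne, of h] h(1,2) unfolding box by blast
  have edge: "potential_along D (h \<circ> r) ?I (\<theta> \<circ> r)" if "continuous_on ?I r" "r ` ?I \<subseteq> ?I \<times> ?I" for r
    by (rule potential_along_compose[OF \<theta> that])
  have "potential_along D p ?I (\<lambda>t. \<theta> (0, t))"
    by (rule potential_along_cong[OF edge[of "\<lambda>t. (0, t)"]]) (auto intro!: continuous_intros simp: h)
  from potential_along_unique[OF _ \<phi> this, of 0 1]
  have 1: "\<phi> 1 - \<phi> 0 = \<theta> (0, 1) - \<theta> (0, 0)" by simp
  have "potential_along D q ?I (\<lambda>t. \<theta> (1, t))"
    by (rule potential_along_cong[OF edge[of "\<lambda>t. (1, t)"]]) (auto intro!: continuous_intros simp: h)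
  from potential_along_unique[OF _ \<psi> this, of 0 1]
  have 2: "\<psi> 1 - \<psi> 0 = \<theta> (1, 1) - \<theta> (1, 0)" by simp
  have "h (0, 0) \<in> N" "h (0, 1) \<in> N" using h(2) by auto
  then have pN: "p 0 \<in> N" "p 1 \<in> N" using h(5)[of 0] h(6)[of 0] by simp_all
  have "potential_along D (\<lambda>_. p 0) ?I (\<lambda>t. \<theta> (t, 0))"
    by (rule potential_along_cong[OF edge[of "\<lambda>t. (t, 0)"]]) (auto intro!: continuous_intros simp: h)
  from potential_along_const[OF _ D pN(1) this, of 0 1] have 3: "\<theta> (1, 0) = \<theta> (0, 0)" by simp
  have "potential_along D (\<lambda>_. p 1) ?I (\<lambda>t. \<theta> (t, 1))"
    by (rule potential_along_cong[OF edge[of "\<lambda>t. (t, 1)"]]) (auto intro!: continuous_intros simp: h)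
  from potential_along_const[OF _ D pN(2) this, of 0 1] have 4: "\<theta> (1, 1) = \<theta> (0, 1)" by simp
  show ?thesis using 1 2 3 4 by simp
qed

lemma potential_along_joinpaths:
  assumes D: "local_cocycle N D" and p: "path p" "path_image p \<subseteq> N" and q: "path q" "path_image q \<subseteq> N"
    and pq: "pathfinish p = pathstart q"
    and \<phi>: "potential_along D p {0..1} \<phi>" and \<psi>: "potential_along D q {0..1} \<psi>"
  shows "\<exists>\<theta>. potential_along D (p +++ q) {0..1} \<theta> \<and> \<theta> 1 - \<theta> 0 = (\<phi> 1 - \<phi> 0) + (\<psi> 1 - \<psi> 0)"
proof -
  let ?h = "p +++ q"
  let ?\<theta> = "\<lambda>t. if t \<le> 1/2 then \<phi> (2 * t) else \<psi> (2 * t - 1) + (\<phi> 1 - \<psi> 0)"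
  have U: "{0..1/2} \<union> {1/2..1} = {0..1::real}" by auto
  have pq': "q 0 = p 1" using pq by (simp add: pathfinish_def pathstart_def)
  have "potential_along D (p \<circ> (\<lambda>t. 2 * t)) {0..1/2} (\<phi> \<circ> (\<lambda>t. 2 * t))"
    by (rule potential_along_compose[OF \<phi>]) (auto intro!: continuous_intros)
  then have 1: "potential_along D ?h {0..1/2} ?\<theta>"
    by (rule potential_along_cong) (auto simp: joinpaths_def)
  have "potential_along D (q \<circ> (\<lambda>t. 2 * t - 1)) {1/2..1} (\<psi> \<circ> (\<lambda>t. 2 * t - 1))"
    by (rule potential_along_compose[OF \<psi>]) (auto intro!: continuous_intros)
  from potential_along_add_const[OF this, of "\<phi> 1 - \<psi> 0"]
  have 2: "potential_along D ?h {1/2..1} ?\<theta>"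
    by (rule potential_along_cong) (auto simp: joinpaths_def pq' field_simps)
  have "path ?h" "path_image ?h \<subseteq> N" using p q pq by (simp_all add: path_join_imp subset_path_image_join)
  then have "potential_along D ?h ({0..1/2} \<union> {1/2..1}) ?\<theta>"
    by (intro potential_along_Un[OF D _ _ _ _ 1 2]) (auto simp: U path_def path_image_def)
  then show ?thesis unfolding U by (intro exI[of _ ?\<theta>]) (simp add: algebra_simps)
qed

text \<open>The value of \<open>f\<close> at \<open>x\<close> is the increment of a potential along any path from a base point to \<open>x\<close>.
  Appending a segment to the path shows that inside a small ball \<open>f\<close> changes by \<open>D\<close>.\<close>
lemma local_cocycle_imp_coboundary:
  fixes N :: "'a::real_normed_vector set" and D :: "'a \<Rightarrow> 'a \<Rightarrow> 'b::ab_group_add"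
  assumes N: "open N" "simply_connected N" and D: "local_cocycle N D"
  shows "\<exists>f. \<forall>x\<in>N. \<exists>r>0. ball x r \<subseteq> N \<and> (\<forall>a\<in>ball x r. \<forall>b\<in>ball x r. f b - f a = D a b)"
proof (cases "N = {}")
  case False
  then obtain w where w: "w \<in> N" by blast
  have pc: "path_connected N" using N(2) by (rule simply_connected_imp_path_connected)
  have ne: "box (0::real) 1 \<noteq> {}" by simp
  have ex: "\<exists>\<phi>. potential_along D p {0..1} \<phi>" if "path p" "path_image p \<subseteq> N" for p
    using potential_along_cbox_exists[OF D _ _ ne, of p] that by (simp add: path_def path_image_def)
  have "\<exists>p \<phi>. path p \<and> path_image p \<subseteq> N \<and> pathstart p = w \<and> pathfinish p = x \<and> potential_along D p {0..1} \<phi>"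
    if "x \<in> N" for x
    using pc w that ex unfolding path_connected_def by metis
  then obtain p \<phi> where p: "\<And>x. x \<in> N \<Longrightarrow> path (p x)" "\<And>x. x \<in> N \<Longrightarrow> path_image (p x) \<subseteq> N"
      "\<And>x. x \<in> N \<Longrightarrow> pathstart (p x) = w" "\<And>x. x \<in> N \<Longrightarrow> pathfinish (p x) = x"
      "\<And>x. x \<in> N \<Longrightarrow> potential_along D (p x) {0..1} (\<phi> x)"
    by metis
  define f where "f x = \<phi> x 1 - \<phi> x 0" for x
  have f: "f x = \<psi> 1 - \<psi> 0"
    if "path q" "path_image q \<subseteq> N" "pathstart q = w" "pathfinish q = x" "potential_along D q {0..1} \<psi>" for q x \<psi>
  proof -
    have x: "x \<in> N" using that by auto
    have "homotopic_paths N (p x) q"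
      using N(2) that p[OF x] unfolding simply_connected_eq_homotopic_paths by metis
    from potential_along_homotopic_paths[OF D this p(5)[OF x] that(5)] show ?thesis by (simp add: f_def)
  qed
  have "\<exists>r>0. ball x r \<subseteq> N \<and> (\<forall>a\<in>ball x r. \<forall>b\<in>ball x r. f b - f a = D a b)" if x: "x \<in> N" for x
  proof -
    obtain U where U: "open U" "x \<in> U" "\<And>a b c. \<lbrakk>a \<in> U; b \<in> U; c \<in> U\<rbrakk> \<Longrightarrow> D a b + D b c = D a c"
      using local_cocycleE[OF D x] by metis
    obtain r where r: "r > 0" "ball x r \<subseteq> U \<inter> N"
      using U N(1) x by (meson IntI open_Int open_contains_ball)
    have star: "f b - f x = D x b" if b: "b \<in> ball x r" for b
    proof -
      let ?l = "linepath x b"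
      have l: "path_image ?l \<subseteq> ball x r"
        using b r(1) by (simp add: closed_segment_subset)
      have "potential_along D ?l {0..1} (\<lambda>t. D x (?l t))"
      proof (rule potential_along_star)
        fix s t :: real assume "s \<in> {0..1}" "t \<in> {0..1}"
        then have "?l s \<in> path_image ?l" "?l t \<in> path_image ?l" unfolding path_image_def by blast+
        then have "?l s \<in> U" "?l t \<in> U" using l r(2) by blast+
        then show "D x (?l s) + D (?l s) (?l t) = D x (?l t)" using U by blast
      qed
      moreover have lN: "path_image ?l \<subseteq> N" using l r by auto
      ultimately obtain \<theta> where \<theta>: "potential_along D (p x +++ ?l) {0..1} \<theta>"
        "\<theta> 1 - \<theta> 0 = (\<phi> x 1 - \<phi> x 0) + (D x (?l 1) - D x (?l 0))"
        using potential_along_joinpaths[OF D p(1,2)[OF x] path_linepath lN _ p(5)[OF x]] p(4)[OF x] by auto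
      have "f b = \<theta> 1 - \<theta> 0"
        by (rule f[OF _ _ _ _ \<theta>(1)]) (use p[OF x] lN in \<open>simp_all add: subset_path_image_join del: path_image_linepath\<close>)
      then show ?thesis
        using \<theta>(2) local_cocycle_refl[OF D x] by (simp add: f_def linepath_def)
    qed
    have "f b - f a = D a b" if "a \<in> ball x r" "b \<in> ball x r" for a b
    proof -
      have "D x a + D a b = D x b" using U r that by blast
      moreover have "f b - f a = (f b - f x) - (f a - f x)" by simp
      ultimately show ?thesis using star that by (metis add_diff_cancel_left')
    qed
    then show ?thesis using r by blast
  qed
  then show ?thesis by blast
qed simp

section \<open>Integrals over segments and triangles\<close>

definition seg_integral :: "('a::euclidean_space \<Rightarrow> 'a) \<Rightarrow> 'a \<Rightarrow> 'a \<Rightarrow> real" where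
  "seg_integral G a b = integral {0..1} (\<lambda>t. G (linepath a b t) \<bullet> (b - a))"

lemma has_integral_seg_integral:
  assumes "continuous_on (closed_segment a b) G"
  shows "((\<lambda>t. G (linepath a b t) \<bullet> (b - a)) has_integral seg_integral G a b) {0..1}"
  unfolding seg_integral_def
proof (intro integrable_integral integrable_continuous_real continuous_intros)
  show "continuous_on {0..1} (\<lambda>t. G (linepath a b t))"
    using continuous_on_compose2[OF assms continuous_on_linepath[of "{0..1}" a b]]
    by (simp add: linepath_image_01)
qed

lemma seg_integral_reverse:
  assumes "continuous_on (closed_segment a b) G"
  shows "seg_integral G b a = - seg_integral G a b"
proof -
  have "((\<lambda>t. G (linepath a b (- 1 *\<^sub>R t + 1)) \<bullet> (b - a)) has_integral seg_integral G a b) {0..1}"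
    using has_integral_affinity[OF has_integral_seg_integral[OF assms, folded cbox_interval], of "-1" 1]
    by (simp add: image_affinity_atLeastAtMost image_affinity_atLeastAtMost_diff)
  from has_integral_neg[OF this]
  have "((\<lambda>t. G (linepath b a t) \<bullet> (a - b)) has_integral - seg_integral G a b) {0..1}"
    by (simp add: linepath_def algebra_simps)
  then show ?thesis unfolding seg_integral_def by (rule integral_unique)
qed

lemma seg_integral_midpoint:
  assumes "continuous_on (closed_segment a b) G"
  shows "seg_integral G a b = seg_integral G a (midpoint a b) + seg_integral G (midpoint a b) b"
proof -
  let ?g = "\<lambda>t. G (linepath a b t) \<bullet> (b - a)"
  have half: "(?g has_integral seg_integral G (linepath a b s) (linepath a b (s + 1/2))) {s..s + 1/2}"
     if "0 \<le> s" "s \<le> 1/2" for s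
  proof -
    let ?x = "linepath a b s" and ?y = "linepath a b (s + 1/2)"
    have xy: "?x \<in> closed_segment a b" "?y \<in> closed_segment a b"
      using that linepath_image_01[of a b] by auto
    have "?y - ?x = ((s + 1/2) - s) *\<^sub>R (b - a)"
      unfolding linepath_def by (simp only: algebra_simps)
    then have d: "?y - ?x = (1/2) *\<^sub>R (b - a)" by simp
    have l: "linepath ?x ?y (2 * t + - (2 * s)) = linepath a b t" for t
    proof -
      have "linepath ?x ?y u = ?x + u *\<^sub>R (?y - ?x)" for u by (simp add: linepath_def algebra_simps)
      then have "linepath ?x ?y (2 * t + - (2 * s)) = ?x + ((2 * t + - (2 * s)) * (1 / 2)) *\<^sub>R (b - a)"
        unfolding d by (simp only: scaleR_scaleR)
      also have "(2 * t + - (2 * s)) * (1 / 2) = t - s" by simp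
      finally show ?thesis by (simp add: linepath_def algebra_simps)
    qed
    have img: "(\<lambda>x::real. x / 2 + s) ` {0..1} = {s..s + 1/2}"
      using image_affinity_atLeastAtMost[of "1/2" s 0 1] by simp
    have "continuous_on (closed_segment ?x ?y) G"
      using xy by (intro continuous_on_subset[OF assms] closed_segment_subset) auto
    from has_integral_affinity[OF has_integral_seg_integral[OF this, folded cbox_interval], of 2 "- (2 * s)"]
    have "((\<lambda>t. G (linepath a b t) \<bullet> ((1/2) *\<^sub>R (b - a))) has_integral seg_integral G ?x ?y / 2) {s..s + 1/2}"
      unfolding real_scaleR_def l d by (simp add: img)
    from has_integral_mult_right[OF this, of 2] show ?thesis by simp
  qed
  have "(?g has_integral seg_integral G a (midpoint a b) + seg_integral G (midpoint a b) b) {0..1}"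
  proof (rule has_integral_combine)
    have "linepath a b (1/2) = midpoint a b" by (simp add: linepath_def midpoint_def scaleR_add_right)
    then show "(?g has_integral seg_integral G a (midpoint a b)) {0..1/2}"
      "(?g has_integral seg_integral G (midpoint a b) b) {1/2..1}"
      using half[of 0] half[of "1/2"] by (simp_all add: linepath_1' linepath_0')
  qed simp_all
  then show ?thesis unfolding seg_integral_def by (rule integral_unique)
qed

text \<open>For self-adjoint \<open>L\<close> the affine field \<open>w \<mapsto> g + L (w - p)\<close> is the gradient of
  \<open>w \<mapsto> g \<bullet> w + L (w - p) \<bullet> (w - p) / 2\<close>. Its integral is thus a difference of values, and
  only the deviation of \<open>G\<close> from it contributes an error.\<close>
lemma seg_integral_approx:
  fixes G :: "'a::euclidean_space \<Rightarrow> 'a"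
  assumes G: "continuous_on (closed_segment a b) G"
    and L: "linear L" "\<And>u v. L u \<bullet> v = u \<bullet> L v"
    and B: "\<And>w. w \<in> closed_segment a b \<Longrightarrow> norm (G w - (g + L (w - p))) \<le> B"
  shows "\<bar>seg_integral G a b - ((g \<bullet> b + L (b - p) \<bullet> (b - p) / 2) - (g \<bullet> a + L (a - p) \<bullet> (a - p) / 2))\<bar>
    \<le> B * norm (b - a)"
proof -
  define q where "q w = g \<bullet> w + L (w - p) \<bullet> (w - p) / 2" for w
  have bl: "bounded_linear L" using L(1) by (simp add: linear_conv_bounded_linear)
  have q: "(q has_derivative (\<lambda>\<xi>. (g + L (w - p)) \<bullet> \<xi>)) (at w)" for w
  proof -
    have "(q has_derivative (\<lambda>\<xi>. g \<bullet> \<xi> + (L (w - p) \<bullet> \<xi> + L \<xi> \<bullet> (w - p)) / 2)) (at w)"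
      unfolding q_def by (auto intro!: derivative_eq_intros bounded_linear.has_derivative[OF bl])
    moreover have "L \<xi> \<bullet> (w - p) = L (w - p) \<bullet> \<xi>" for \<xi>
      using L(2)[of \<xi> "w - p"] inner_commute[of \<xi>] by metis
    ultimately show ?thesis by (simp add: inner_add_left)
  qed
  have "((\<lambda>t. (g + L (linepath a b t - p)) \<bullet> (b - a)) has_integral q (linepath a b 1) - q (linepath a b 0)) {0..1}"
  proof (rule fundamental_theorem_of_calculus)
    fix t :: real
    have l: "(linepath a b has_derivative (\<lambda>s. s *\<^sub>R (b - a))) (at t within {0..1})"
      using has_vector_derivative_linepath_within unfolding has_vector_derivative_def by blast
    show "((\<lambda>t. q (linepath a b t)) has_vector_derivative (g + L (linepath a b t - p)) \<bullet> (b - a)) (at t within {0..1})"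
      using has_derivative_compose[OF l q] by (simp add: has_vector_derivative_def)
  qed simp
  then have I: "((\<lambda>t. G (linepath a b t) \<bullet> (b - a) - (g + L (linepath a b t - p)) \<bullet> (b - a)) has_integral
     seg_integral G a b - (q b - q a)) {0..1}"
    by (intro has_integral_diff has_integral_seg_integral G) (simp add: linepath_def)
  have le: "norm (G (linepath a b t) \<bullet> (b - a) - (g + L (linepath a b t - p)) \<bullet> (b - a)) \<le> B * norm (b - a)"
    if "t \<in> {0..1}" for t
  proof -
    have "linepath a b t \<in> closed_segment a b" using that linepath_image_01[of a b] by blast
    from B[OF this] have "norm (G (linepath a b t) - (g + L (linepath a b t - p))) * norm (b - a) \<le> B * norm (b - a)"
      by (simp add: mult_right_mono)
    then show ?thesis
      using Cauchy_Schwarz_ineq2[of "G (linepath a b t) - (g + L (linepath a b t - p))" "b - a"]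
      by (simp add: inner_diff_left)
  qed
  have "0 \<le> B" using B[of a] norm_ge_zero order_trans by blast
  then have "0 \<le> B * norm (b - a)" by simp
  from has_integral_bound[OF this I[folded cbox_interval]] le show ?thesis
    unfolding q_def by simp
qed

definition tri_integral where
  "tri_integral G a b c = seg_integral G a b + seg_integral G b c + seg_integral G c a"

text \<open>The three inner segments are traversed once in each direction.\<close>
lemma tri_integral_quadrisect:
  assumes "continuous_on (convex hull {a, b, c}) G"
  shows "tri_integral G a b c =
    tri_integral G a (midpoint a b) (midpoint c a) + tri_integral G (midpoint a b) b (midpoint b c)
    + tri_integral G (midpoint c a) (midpoint b c) c + tri_integral G (midpoint a b) (midpoint b c) (midpoint c a)"
proof -
  let ?H = "convex hull {a, b, c}"
  have V: "a \<in> ?H" "b \<in> ?H" "c \<in> ?H" by (simp_all add: hull_inc)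
  have cs: "continuous_on (closed_segment x y) G" if "x \<in> ?H" "y \<in> ?H" for x y
    using continuous_on_subset[OF assms] that by (simp add: closed_segment_subset)
  have M: "midpoint x y \<in> ?H" if "x \<in> ?H" "y \<in> ?H" for x y
    using closed_segment_subset[OF that convex_convex_hull] midpoints_in_convex_hull that
    by (metis convex_convex_hull hull_same midpoints_in_convex_hull)
  note Ms = M[OF V(1,2)] M[OF V(2,3)] M[OF V(3,1)]
  show ?thesis
    unfolding tri_integral_def
    using seg_integral_midpoint[OF cs[OF V(1,2)]] seg_integral_midpoint[OF cs[OF V(2,3)]] seg_integral_midpoint[OF cs[OF V(3,1)]]
      seg_integral_reverse[OF cs[OF Ms(1,3)]] seg_integral_reverse[OF cs[OF Ms(1,2)]] seg_integral_reverse[OF cs[OF Ms(2,3)]]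
    by simp
qed

lemma norm_diff_le_in_triangle:
  fixes a b c :: "'a::euclidean_space"
  assumes "norm (a - b) \<le> d" "norm (b - c) \<le> d" "norm (c - a) \<le> d"
    and "p \<in> convex hull {a, b, c}" "w \<in> convex hull {a, b, c}"
  shows "norm (w - p) \<le> d"
proof -
  have d: "0 \<le> d" using assms(1) norm_ge_zero order_trans by blast
  have hull: "convex hull {a, b, c} \<subseteq> cball v d" if "{a, b, c} \<subseteq> cball v d" for v
    using that by (simp add: hull_minimal)
  have "{a, b, c} \<subseteq> cball a d" "{a, b, c} \<subseteq> cball b d" "{a, b, c} \<subseteq> cball c d"
    using assms(1-3) d by (auto simp: dist_norm norm_minus_commute)
  from this[THEN hull] have "{a, b, c} \<subseteq> cball p d"
    using assms(4) by (auto simp: dist_commute)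
  from hull[OF this] have "w \<in> cball p d" using assms(5) by blast
  then show ?thesis by (simp add: dist_norm norm_minus_commute)
qed

text \<open>The differences of the quadratic potential cancel around the triangle. The error is quadratic in
  the size because both the length of the sides and the distance to \<open>p\<close> are at most \<open>d\<close>.\<close>
lemma tri_integral_approx:
  assumes G: "continuous_on (convex hull {a, b, c}) G"
    and L: "linear L" "\<And>u v. L u \<bullet> v = u \<bullet> L v"
    and d: "norm (a - b) \<le> d" "norm (b - c) \<le> d" "norm (c - a) \<le> d"
    and e: "0 \<le> e" "\<And>w. w \<in> convex hull {a, b, c} \<Longrightarrow> norm (G w - (g + L (w - p))) \<le> e * norm (w - p)"
    and p: "p \<in> convex hull {a, b, c}"
  shows "\<bar>tri_integral G a b c\<bar> \<le> 3 * e * d\<^sup>2"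
proof -
  let ?H = "convex hull {a, b, c}"
  define q where "q w = g \<bullet> w + L (w - p) \<bullet> (w - p) / 2" for w
  have V: "a \<in> ?H" "b \<in> ?H" "c \<in> ?H" by (simp_all add: hull_inc)
  have d0: "0 \<le> d" using d(1) norm_ge_zero order_trans by blast
  have side: "\<bar>seg_integral G x y - (q y - q x)\<bar> \<le> e * d\<^sup>2" if xy: "x \<in> ?H" "y \<in> ?H" for x y
  proof -
    have sub: "closed_segment x y \<subseteq> ?H" using xy by (simp add: closed_segment_subset)
    have "\<bar>seg_integral G x y - (q y - q x)\<bar> \<le> (e * d) * norm (y - x)"
      unfolding q_def
    proof (rule seg_integral_approx[OF continuous_on_subset[OF G sub] L])
      fix w assume "w \<in> closed_segment x y"
      then have w: "w \<in> ?H" using sub by blast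
      have "e * norm (w - p) \<le> e * d"
        using norm_diff_le_in_triangle[OF d p w] e(1) by (simp add: mult_left_mono)
      then show "norm (G w - (g + L (w - p))) \<le> e * d" using e(2)[OF w] by simp
    qed
    also have "\<dots> \<le> (e * d) * d"
      using norm_diff_le_in_triangle[OF d xy] e(1) d0 by (intro mult_left_mono) auto
    finally show ?thesis by (simp add: power2_eq_square mult.assoc)
  qed
  show ?thesis
    unfolding tri_integral_def using side[OF V(1,2)] side[OF V(2,3)] side[OF V(3,1)] by linarith
qed

lemma norm_midpoint_diff:
  fixes x :: "'a::real_normed_vector"
  shows "norm (midpoint x y - midpoint x z) = norm (y - z) / 2"
proof -
  have "midpoint x y - midpoint x z = (1/2) *\<^sub>R (y - z)" by (simp add: midpoint_def algebra_simps)
  then show ?thesis by simp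
qed

lemma tri_integral_quadrisect_step:
  fixes G :: "'a::euclidean_space \<Rightarrow> 'a"
  assumes G: "continuous_on (convex hull {a, b, c}) G"
    and d: "norm (a - b) \<le> d" "norm (b - c) \<le> d" "norm (c - a) \<le> d"
    and e: "e \<le> \<bar>tri_integral G a b c\<bar>"
  shows "\<exists>a' b' c'. convex hull {a', b', c'} \<subseteq> convex hull {a, b, c} \<and>
    norm (a' - b') \<le> d / 2 \<and> norm (b' - c') \<le> d / 2 \<and> norm (c' - a') \<le> d / 2 \<and>
    e / 4 \<le> \<bar>tri_integral G a' b' c'\<bar>"
proof -
  let ?H = "convex hull {a, b, c}"
  let ?x = "midpoint a b" and ?y = "midpoint b c" and ?z = "midpoint c a"
  have V: "a \<in> ?H" "b \<in> ?H" "c \<in> ?H" by (simp_all add: hull_inc)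
  have M: "?x \<in> ?H" "?y \<in> ?H" "?z \<in> ?H"
    using V by (metis convex_convex_hull hull_same midpoints_in_convex_hull)+
  have sub: "convex hull {u, v, w} \<subseteq> ?H" if "u \<in> ?H" "v \<in> ?H" "w \<in> ?H" for u v w
    using that by (simp add: hull_minimal)
  have s: "norm (a - ?x) \<le> d / 2" "norm (?x - ?z) \<le> d / 2" "norm (?z - a) \<le> d / 2"
    "norm (?x - b) \<le> d / 2" "norm (b - ?y) \<le> d / 2" "norm (?y - ?x) \<le> d / 2"
    "norm (?z - ?y) \<le> d / 2" "norm (?y - c) \<le> d / 2" "norm (c - ?z) \<le> d / 2"
    using norm_midpoint_diff[of a a b] norm_midpoint_diff[of a b c] norm_midpoint_diff[of a c a]
      norm_midpoint_diff[of b a b] norm_midpoint_diff[of b b c] norm_midpoint_diff[of b c a]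
      norm_midpoint_diff[of c a b] norm_midpoint_diff[of c b c] norm_midpoint_diff[of c c a] d
    by (simp_all add: midpoint_sym norm_minus_commute)
  have "\<bar>tri_integral G a b c\<bar> \<le> \<bar>tri_integral G a ?x ?z\<bar> + \<bar>tri_integral G ?x b ?y\<bar>
      + \<bar>tri_integral G ?z ?y c\<bar> + \<bar>tri_integral G ?x ?y ?z\<bar>"
    unfolding tri_integral_quadrisect[OF G] by linarith
  then consider "e / 4 \<le> \<bar>tri_integral G a ?x ?z\<bar>" | "e / 4 \<le> \<bar>tri_integral G ?x b ?y\<bar>"
    | "e / 4 \<le> \<bar>tri_integral G ?z ?y c\<bar>" | "e / 4 \<le> \<bar>tri_integral G ?x ?y ?z\<bar>"
    using e by linarith
  then show ?thesis
  proof cases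
    case 1
    then show ?thesis using s sub[OF V(1) M(1) M(3)] by blast
  next
    case 2
    then show ?thesis using s sub[OF M(1) V(2) M(2)] by blast
  next
    case 3
    then show ?thesis using s sub[OF M(3) M(2) V(3)] by blast
  next
    case 4
    moreover have "norm (?x - ?y) \<le> d / 2" "norm (?y - ?z) \<le> d / 2" "norm (?z - ?x) \<le> d / 2"
      using s by (simp_all add: norm_minus_commute)
    ultimately show ?thesis using sub[OF M] by blast
  qed
qed

text \<open>Goursat's lemma for fields with self-adjoint derivative. Bisecting the sides repeatedly, choose
  triangles of size \<open>d / 2^n\<close> whose integral is at least \<open>T / 4^n\<close>. They shrink to a point where \<open>G\<close> is
  differentiable, and there \<open>tri_integral_approx\<close> bounds the integral by a small multiple of
  \<open>(d / 2^n)\<^sup>2\<close>, which is of the same order.\<close>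
lemma tri_integral_closed_field_zero:
  fixes G :: "'a::euclidean_space \<Rightarrow> 'a"
  assumes der: "\<And>w. w \<in> convex hull {a, b, c} \<Longrightarrow> (G has_derivative G' w) (at w within convex hull {a, b, c})"
    and sym: "\<And>w u v. w \<in> convex hull {a, b, c} \<Longrightarrow> G' w u \<bullet> v = u \<bullet> G' w v"
  shows "tri_integral G a b c = 0"
proof (rule ccontr)
  assume T0: "tri_integral G a b c \<noteq> 0"
  let ?H = "convex hull {a, b, c}"
  define T where "T = \<bar>tri_integral G a b c\<bar>"
  \<comment> \<open>The summand 1 keeps \<open>d\<close> positive without a case distinction for one-point triangles.\<close>
  define d where "d = norm (a - b) + norm (b - c) + norm (c - a) + 1"
  have d: "d > 0" "norm (a - b) \<le> d" "norm (b - c) \<le> d" "norm (c - a) \<le> d"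
    unfolding d_def using norm_ge_zero[of "a - b"] norm_ge_zero[of "b - c"] norm_ge_zero[of "c - a"] by linarith+
  have T: "T > 0" using T0 by (simp add: T_def)
  have contG: "continuous_on ?H G"
    unfolding continuous_on_eq_continuous_within using has_derivative_continuous[OF der] by blast
  define P where "P n t = (case t of (x, y, z) \<Rightarrow> convex hull {x, y, z} \<subseteq> ?H \<and>
    norm (x - y) \<le> d / 2 ^ n \<and> norm (y - z) \<le> d / 2 ^ n \<and> norm (z - x) \<le> d / 2 ^ n \<and>
    T / 4 ^ n \<le> \<bar>tri_integral G x y z\<bar>)" for n :: nat and t
  define Q where "Q t t' = (case t of (x, y, z) \<Rightarrow> case t' of (x', y', z') \<Rightarrow>
     convex hull {x', y', z'} \<subseteq> convex hull {x, y, z})" for t t' :: "'a \<times> 'a \<times> 'a"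
  have "\<exists>t. P 0 t" using d by (intro exI[of _ "(a, b, c)"]) (simp add: P_def T_def)
  moreover have "\<exists>t'. P (Suc n) t' \<and> Q t t'" if "P n t" for t n
  proof -
    obtain x y z where t: "t = (x, y, z)" by (cases t)
    have Pt: "convex hull {x, y, z} \<subseteq> ?H" "norm (x - y) \<le> d / 2 ^ n" "norm (y - z) \<le> d / 2 ^ n"
      "norm (z - x) \<le> d / 2 ^ n" "T / 4 ^ n \<le> \<bar>tri_integral G x y z\<bar>"
      using that by (simp_all add: P_def t)
    obtain x' y' z' where "convex hull {x', y', z'} \<subseteq> convex hull {x, y, z}"
      "norm (x' - y') \<le> d / 2 ^ n / 2" "norm (y' - z') \<le> d / 2 ^ n / 2" "norm (z' - x') \<le> d / 2 ^ n / 2"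
      "T / 4 ^ n / 4 \<le> \<bar>tri_integral G x' y' z'\<bar>"
      using tri_integral_quadrisect_step[OF continuous_on_subset[OF contG Pt(1)] Pt(2-5)] by blast
    with Pt(1) show ?thesis
      by (intro exI[of _ "(x', y', z')"]) (auto simp: P_def Q_def t mult.commute)
  qed
  ultimately obtain t where t: "\<And>n. P n (t n)" "\<And>n. Q (t n) (t (Suc n))"
    using dependent_nat_choice[of P "\<lambda>_. Q"] by metis
  define K where "K n = (case t n of (x, y, z) \<Rightarrow> convex hull {x, y, z})" for n
  have K_Suc: "K (Suc n) \<subseteq> K n" for n
    using t(2)[of n] by (auto simp: Q_def K_def split: prod.splits)
  have "\<Inter> (range K) \<noteq> {}"
  proof (rule compact_nest)
    show "compact (K n)" "K n \<noteq> {}" for n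
      by (auto simp: K_def split: prod.splits intro!: compact_convex_hull)
    show "K n \<subseteq> K m" if "m \<le> n" for m n
      by (rule lift_Suc_antimono_le[of K, OF K_Suc that])
  qed
  then obtain p where p: "\<And>n. p \<in> K n" by blast
  have KH: "K n \<subseteq> ?H" for n using t(1)[of n] by (auto simp: P_def K_def split: prod.splits)
  have pH: "p \<in> ?H" using p KH by blast
  \<comment> \<open>This tolerance turns the bound \<open>3 * e * d\<^sup>2\<close> into \<open>T / 2\<close>.\<close>
  define e where "e = T / (6 * d\<^sup>2)"
  have e: "e > 0" using T d by (simp add: e_def)
  obtain r where r: "r > 0"
    "\<And>w. w \<in> ?H \<Longrightarrow> norm (w - p) < r \<Longrightarrow> norm (G w - G p - G' p (w - p)) \<le> e * norm (w - p)"
    using der[OF pH] e unfolding has_derivative_within_alt by blast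
  obtain n where n: "d / 2 ^ n < r"
  proof -
    obtain n where "d / r < 2 ^ n" using real_arch_pow[of 2 "d / r"] by auto
    then show thesis using that[of n] r(1) by (simp add: field_simps)
  qed
  obtain x y z where xyz: "t n = (x, y, z)" by (cases "t n")
  have Pn: "norm (x - y) \<le> d / 2 ^ n" "norm (y - z) \<le> d / 2 ^ n" "norm (z - x) \<le> d / 2 ^ n"
     "T / 4 ^ n \<le> \<bar>tri_integral G x y z\<bar>" and Kn: "K n = convex hull {x, y, z}"
    using t(1)[of n] by (auto simp: P_def K_def xyz)
  have pn: "p \<in> convex hull {x, y, z}" using p[of n] Kn by simp
  have "\<bar>tri_integral G x y z\<bar> \<le> 3 * e * (d / 2 ^ n)\<^sup>2"
  proof (rule tri_integral_approx[OF _ _ _ Pn(1-3) _ _ pn])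
    show "continuous_on (convex hull {x, y, z}) G"
      using contG KH[of n] Kn continuous_on_subset by metis
    show "linear (G' p)" using der[OF pH] has_derivative_linear by blast
    show "G' p u \<bullet> v = u \<bullet> G' p v" for u v using sym[OF pH] .
    show "0 \<le> e" using e by simp
    fix w assume w: "w \<in> convex hull {x, y, z}"
    have "norm (w - p) < r" using norm_diff_le_in_triangle[OF Pn(1-3) pn w] n by linarith
    moreover have "w \<in> ?H" using w KH[of n] Kn by blast
    ultimately show "norm (G w - (G p + G' p (w - p))) \<le> e * norm (w - p)"
      using r(2)[of w] by (simp add: algebra_simps)
  qed
  also have "\<dots> = (T / 2) / 4 ^ n"
  proof -
    have "(2 ^ n)\<^sup>2 = (4::real) ^ n" by (metis four_x_squared mult_2 numeral_Bit0 power2_eq_square power_mult_distrib)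
    then show ?thesis using d(1) by (simp add: e_def power_divide field_simps)
  qed
  finally show False using Pn(4) T by (simp add: field_simps)
qed

section \<open>Potentials of closed fields and line integrals\<close>

lemma closed_field_local_cocycle:
  fixes G :: "'a::euclidean_space \<Rightarrow> 'a"
  assumes N: "open N" and der: "\<And>w. w \<in> N \<Longrightarrow> (G has_derivative G' w) (at w)"
    and sym: "\<And>w u v. w \<in> N \<Longrightarrow> G' w u \<bullet> v = u \<bullet> G' w v"
  shows "local_cocycle N (seg_integral G)"
  unfolding local_cocycle_def
proof
  fix x assume "x \<in> N"
  then obtain r where r: "r > 0" "ball x r \<subseteq> N" using N open_contains_ball by blast
  have "seg_integral G a b + seg_integral G b c = seg_integral G a c"
    if abc: "a \<in> ball x r" "b \<in> ball x r" "c \<in> ball x r" for a b c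
  proof -
    have "convex hull {a, b, c} \<subseteq> ball x r"
      by (rule hull_minimal) (use abc in simp_all)
    then have hull: "convex hull {a, b, c} \<subseteq> N" using r(2) by (rule subset_trans)
    have seg: "closed_segment a c \<subseteq> N"
      using closed_segment_subset[OF abc(1,3) convex_ball] r(2) by (rule subset_trans)
    have "tri_integral G a b c = 0"
    proof (rule tri_integral_closed_field_zero)
      fix w assume "w \<in> convex hull {a, b, c}"
      then have w: "w \<in> N" using hull by blast
      show "(G has_derivative G' w) (at w within convex hull {a, b, c})"
        using der[OF w] by (rule has_derivative_at_withinI)
      show "G' w u \<bullet> v = u \<bullet> G' w v" for u v by (rule sym[OF w])
    qed
    moreover have "continuous_on (closed_segment a c) G"
      using seg by (intro continuous_at_imp_continuous_on ballI has_derivative_continuous[OF der]) blast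
    from seg_integral_reverse[OF this] have "seg_integral G c a = - seg_integral G a c" .
    ultimately show ?thesis by (simp add: tri_integral_def)
  qed
  then show "\<exists>U. open U \<and> x \<in> U \<and>
      (\<forall>a\<in>U. \<forall>b\<in>U. \<forall>c\<in>U. seg_integral G a b + seg_integral G b c = seg_integral G a c)"
    using r(1) by (intro exI[of _ "ball x r"]) simp
qed

text \<open>Near \<open>w\<close>, compare \<open>G\<close> with the constant field \<open>G w\<close>, which is the approximation with \<open>L = 0\<close>.\<close>
lemma has_derivative_of_seg_integral:
  fixes G :: "'a::euclidean_space \<Rightarrow> 'a"
  assumes r: "r > 0" and cont: "continuous_on (ball w r) G"
    and f: "\<And>y. y \<in> ball w r \<Longrightarrow> f y - f w = seg_integral G w y"
  shows "(f has_derivative (\<lambda>\<xi>. G w \<bullet> \<xi>)) (at w)"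
  unfolding has_derivative_at_alt
proof (intro conjI allI impI)
  show "bounded_linear (\<lambda>\<xi>. G w \<bullet> \<xi>)" by (rule bounded_linear_inner_right)
  fix e :: real assume e: "e > 0"
  have "isCont G w" using cont r by (simp add: continuous_on_eq_continuous_at)
  then obtain d where d: "d > 0" "\<And>y. dist y w < d \<Longrightarrow> dist (G y) (G w) < e"
    using e unfolding continuous_at_eps_delta by blast
  show "\<exists>d>0. \<forall>y. norm (y - w) < d \<longrightarrow> norm (f y - f w - G w \<bullet> (y - w)) \<le> e * norm (y - w)"
  proof (intro exI[of _ "min d r"] conjI allI impI)
    show "0 < min d r" using d r by simp
    fix y assume y: "norm (y - w) < min d r"
    then have yb: "y \<in> ball w r" by (simp add: dist_norm norm_minus_commute)
    have seg: "closed_segment w y \<subseteq> ball w r"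
      using yb r by (intro closed_segment_subset) auto
    have "\<bar>seg_integral G w y - ((G w \<bullet> y + (0::'a) \<bullet> (y - w) / 2) - (G w \<bullet> w + (0::'a) \<bullet> (w - w) / 2))\<bar>
        \<le> e * norm (y - w)"
    proof (rule seg_integral_approx)
      show "continuous_on (closed_segment w y) G" by (rule continuous_on_subset[OF cont seg])
      fix z assume "z \<in> closed_segment w y"
      then have "norm (z - w) \<le> norm (y - w)" by (rule segment_bound1)
      then have "dist (G z) (G w) < e" using d(2)[of z] y by (simp add: dist_norm)
      then show "norm (G z - (G w + 0)) \<le> e" by (simp add: dist_norm)
    qed (simp_all add: linear_zero)
    then show "norm (f y - f w - G w \<bullet> (y - w)) \<le> e * norm (y - w)"
      using f[OF yb] by (simp add: inner_diff_right algebra_simps)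
  qed
qed

text \<open>The Poincare lemma without continuity of the derivative. By Goursat's lemma the integrals over segments
  form a local cocycle, and a function whose local differences they are has the gradient \<open>G\<close>.\<close>
theorem closed_field_has_potential:
  fixes G :: "'a::euclidean_space \<Rightarrow> 'a"
  assumes N: "open N" "simply_connected N"
    and der: "\<And>w. w \<in> N \<Longrightarrow> (G has_derivative G' w) (at w)"
    and sym: "\<And>w u v. w \<in> N \<Longrightarrow> G' w u \<bullet> v = u \<bullet> G' w v"
  obtains f where "\<And>w. w \<in> N \<Longrightarrow> (f has_derivative (\<lambda>\<xi>. G w \<bullet> \<xi>)) (at w)"
proof -
  have "local_cocycle N (seg_integral G)"
    by (rule closed_field_local_cocycle[OF N(1) der sym])
  from local_cocycle_imp_coboundary[OF N this]
  obtain f where f: "\<forall>x\<in>N. \<exists>r>0. ball x r \<subseteq> N \<and>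
      (\<forall>a\<in>ball x r. \<forall>b\<in>ball x r. f b - f a = seg_integral G a b)" by blast
  have "(f has_derivative (\<lambda>\<xi>. G w \<bullet> \<xi>)) (at w)" if w: "w \<in> N" for w
  proof -
    obtain r where r: "r > 0" "ball w r \<subseteq> N"
      and fr: "\<forall>a\<in>ball w r. \<forall>b\<in>ball w r. f b - f a = seg_integral G a b"
      using bspec[OF f w] by blast
    have "continuous_on (ball w r) G"
      using r(2) by (intro continuous_at_imp_continuous_on ballI has_derivative_continuous[OF der]) blast
    with r(1) show ?thesis
      by (rule has_derivative_of_seg_integral) (use fr r(1) in simp)
  qed
  then show thesis by (rule that)
qed

lemma gradient_line_integral:
  fixes G :: "'a::euclidean_space \<Rightarrow> 'a" and \<gamma> :: "real \<Rightarrow> 'a"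
  assumes der: "\<And>w. w \<in> N \<Longrightarrow> (f has_derivative (\<lambda>\<xi>. G w \<bullet> \<xi>)) (at w)"
    and \<gamma>: "valid_path \<gamma>" "path_image \<gamma> \<subseteq> N"
  shows "((\<lambda>t. G (\<gamma> t) \<bullet> vector_derivative \<gamma> (at t within {0..1})) has_integral
           f (pathfinish \<gamma>) - f (pathstart \<gamma>)) {0..1}"
proof -
  obtain K where K: "finite K" "continuous_on {0..1} \<gamma>" "\<gamma> C1_differentiable_on {0..1} - K"
    using \<gamma>(1) unfolding valid_path_def piecewise_C1_differentiable_on_def by blast
  have \<gamma>N: "\<gamma> t \<in> N" if "t \<in> {0..1}" for t using \<gamma>(2) that unfolding path_image_def by blast
  have "((\<lambda>t. G (\<gamma> t) \<bullet> vector_derivative \<gamma> (at t within {0..1})) has_integral f (\<gamma> 1) - f (\<gamma> 0)) {0..1}"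
  proof (rule fundamental_theorem_of_calculus_interior_strong[OF K(1)])
    fix t :: real assume t: "t \<in> {0<..<1} - K"
    have "\<gamma> differentiable (at t)" using K(3) t unfolding C1_differentiable_on_eq by auto
    then have "(\<gamma> has_vector_derivative vector_derivative \<gamma> (at t)) (at t)"
      by (simp add: vector_derivative_works)
    moreover have "vector_derivative \<gamma> (at t within {0..1}) = vector_derivative \<gamma> (at t)"
      using t by (simp add: at_within_Icc_at)
    ultimately have "(\<gamma> has_derivative (\<lambda>s. s *\<^sub>R vector_derivative \<gamma> (at t within {0..1}))) (at t)"
      by (simp add: has_vector_derivative_def)
    from has_derivative_compose[OF this der[OF \<gamma>N]] t
    show "((\<lambda>t. f (\<gamma> t)) has_vector_derivative G (\<gamma> t) \<bullet> vector_derivative \<gamma> (at t within {0..1})) (at t)"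
      by (simp add: has_vector_derivative_def)
  next
    have "continuous_on N f"
      by (intro continuous_at_imp_continuous_on ballI has_derivative_continuous[OF der])
    then show "continuous_on {0..1} (\<lambda>t. f (\<gamma> t))"
      by (rule continuous_on_compose2[OF _ K(2)]) (use \<gamma>N in blast)
  qed simp
  then show ?thesis by (simp add: pathstart_def pathfinish_def)
qed

text \<open>Open connected sets are connected even by polynomial curves.\<close>
lemma connected_open_valid_path:
  fixes S :: "'a::euclidean_space set"
  assumes "open S" "connected S" "x \<in> S" "y \<in> S"
  obtains \<gamma> where "valid_path \<gamma>" "path_image \<gamma> \<subseteq> S" "pathstart \<gamma> = x" "pathfinish \<gamma> = y"
proof -
  obtain g where g: "polynomial_function g" "path_image g \<subseteq> S" "pathstart g = x" "pathfinish g = y"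
    using connected_open_polynomial_connected[OF assms] by blast
  obtain g' where g': "polynomial_function g'" "\<And>t. (g has_vector_derivative g' t) (at t)"
    using has_vector_derivative_polynomial_function[OF g(1)] by metis
  have "g C1_differentiable_on {0..1}"
    unfolding C1_differentiable_on_def using g' continuous_on_polymonial_function by blast
  then have "valid_path g"
    unfolding valid_path_def by (rule C1_differentiable_imp_piecewise)
  then show thesis using that g by blast
qed

section \<open>Reciprocals in a commutative algebra\<close>

lemma alg_inverse_right:
  assumes "R3_algebra m e" "a \<in> alg_units m e"
  shows "m a (alg_inverse m e a) = e"
proof -
  obtain b where b: "m a b = e" using assms(2) by (auto simp: alg_units_def)
  have uniq: "c = b" if "m a c = e" for c
    using assms(1) b that unfolding R3_algebra_def by metis
  show ?thesis unfolding alg_inverse_def by (rule theI[of "\<lambda>c. m a c = e", OF b uniq])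
qed

text \<open>Where one factor vanishes, the product rule asks only for continuity of the other factor. This is
  what makes the derivative of a reciprocal accessible before its differentiability is known.\<close>
lemma has_derivative_bilinear_vanishing:
  assumes m: "bounded_bilinear m" and g: "isCont g w"
    and f: "(f has_derivative f') (at w)" "f w = 0"
  shows "((\<lambda>x. m (g x) (f x)) has_derivative (\<lambda>\<xi>. m (g w) (f' \<xi>))) (at w)"
proof -
  interpret bounded_bilinear m by (rule m)
  obtain C where C: "C > 0" "\<And>a b. norm (m a b) \<le> norm a * norm b * C" using pos_bounded by blast
  obtain A where A: "A > 0" "\<And>\<xi>. norm (f' \<xi>) \<le> norm \<xi> * A"
    using bounded_linear.pos_bounded[OF has_derivative_bounded_linear[OF f(1)]] by blast
  have "((\<lambda>x. m (g x - g w) (f x)) has_derivative (\<lambda>\<xi>. 0)) (at w)"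
    unfolding has_derivative_at_alt
  proof (intro conjI allI impI)
    fix e :: real assume e: "e > 0"
    obtain d1 where d1: "d1 > 0" "\<And>x. norm (x - w) < d1 \<Longrightarrow> norm (f x - f w - f' (x - w)) \<le> 1 * norm (x - w)"
      using f(1)[unfolded has_derivative_at_alt] zero_less_one by blast
    have "e / ((1 + A) * C) > 0" using e A C by simp
    then obtain d2 where d2: "d2 > 0" "\<And>x. dist x w < d2 \<Longrightarrow> dist (g x) (g w) < e / ((1 + A) * C)"
      using g unfolding continuous_at_eps_delta by blast
    show "\<exists>d>0. \<forall>y. norm (y - w) < d \<longrightarrow> norm (m (g y - g w) (f y) - m (g w - g w) (f w) - 0) \<le> e * norm (y - w)"
    proof (intro exI[of _ "min d1 d2"] conjI allI impI)
      show "0 < min d1 d2" using d1 d2 by simp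
      fix y assume y: "norm (y - w) < min d1 d2"
      have "norm (f y) \<le> norm (f y - f w - f' (y - w)) + norm (f' (y - w))"
        using norm_triangle_ineq[of "f y - f' (y - w)" "f' (y - w)"] f(2) by simp
      then have fy: "norm (f y) \<le> (1 + A) * norm (y - w)"
        using d1(2)[of y] A(2)[of "y - w"] y by (simp add: algebra_simps)
      have gy: "norm (g y - g w) \<le> e / ((1 + A) * C)"
        using d2(2)[of y] y by (simp add: dist_norm)
      have "norm (m (g y - g w) (f y)) \<le> norm (g y - g w) * norm (f y) * C" by (rule C)
      also have "\<dots> \<le> e / ((1 + A) * C) * ((1 + A) * norm (y - w)) * C"
        using fy gy e A(1) C(1) by (intro mult_mono mult_right_mono) auto
      also have "\<dots> = e * norm (y - w)" using A(1) C(1) by simp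
      finally show "norm (m (g y - g w) (f y) - m (g w - g w) (f w) - 0) \<le> e * norm (y - w)"
        by (simp add: f(2) zero_right)
    qed
  qed simp
  moreover have "((\<lambda>x. m (g w) (f x)) has_derivative (\<lambda>\<xi>. m (g w) (f' \<xi>))) (at w)"
    by (rule bounded_linear.has_derivative[OF bounded_linear_right f(1)])
  ultimately have "((\<lambda>x. m (g x - g w) (f x) + m (g w) (f x)) has_derivative (\<lambda>\<xi>. 0 + m (g w) (f' \<xi>))) (at w)"
    by (rule has_derivative_add)
  then show ?thesis by (simp add: diff_left)
qed

text \<open>The identity \<open>K x = K w - K x (K w (F x - F w))\<close> does all the work. First it shows that \<open>K\<close> is
  bounded near \<open>w\<close> and hence continuous at \<open>w\<close>. Then the product rule for a vanishing factor
  differentiates its right hand side.\<close>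
lemma has_derivative_alg_inverse:
  assumes alg: "R3_algebra m e" and w: "open N" "w \<in> N"
    and FK: "\<And>x. x \<in> N \<Longrightarrow> m (F x) (K x) = e"
    and F: "(F has_derivative (\<lambda>\<xi>. m F' \<xi>)) (at w)"
  shows "(K has_derivative (\<lambda>\<xi>. m (- m (K w) (m (K w) F')) \<xi>)) (at w)"
proof -
  have bil: "bounded_bilinear m" using alg by (simp add: R3_algebra_def bilinear_conv_bounded_bilinear)
  interpret bounded_bilinear m by (rule bil)
  have assoc: "m (m x y) z = m x (m y z)" and comm: "m x y = m y x" and unit: "m e x = x" for x y z
    using alg by (auto simp: R3_algebra_def)
  define u where "u x = m (K w) (F x - F w)" for x
  have id: "K x = K w - m (K x) (u x)" if "x \<in> N" for x
  proof -
    have "m (K x) (m (K w) (F x)) = m (K w) (m (F x) (K x))" by (metis assoc comm)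
    then have "m (K x) (m (K w) (F x)) = K w" using FK[OF that] unit comm by metis
    moreover have "m (K x) (m (K w) (F w)) = K x" using FK[OF w(2)] unit comm by metis
    ultimately show ?thesis by (simp add: u_def diff_right)
  qed
  have u0: "u w = 0" by (simp add: u_def zero_right)
  have du: "(u has_derivative (\<lambda>\<xi>. m (K w) (m F' \<xi>))) (at w)"
    unfolding u_def using bounded_linear.has_derivative[OF bounded_linear_right has_derivative_diff[OF F has_derivative_const[of "F w"]]]
    by simp
  have "isCont u w" using du by (rule has_derivative_continuous)
  then have u_lim: "(u \<longlongrightarrow> 0) (at w)" using u0 by (simp add: isCont_def)
  obtain C where C: "C > 0" "\<And>a b. norm (m a b) \<le> norm a * norm b * C" using pos_bounded by blast
  have "((\<lambda>x. K x - K w) \<longlongrightarrow> 0) (at w)"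
  proof (rule Lim_null_comparison)
    show "((\<lambda>x. 2 * C * norm (K w) * norm (u x)) \<longlongrightarrow> 0) (at w)"
      using tendsto_mult_right_zero[OF tendsto_norm_zero[OF u_lim]] by simp
    \<comment> \<open>Where \<open>C * norm (u x) \<le> 1 / 2\<close>, the identity gives \<open>norm (K x) \<le> norm (K w) + norm (K x) / 2\<close>.\<close>
    have "\<forall>\<^sub>F x in at w. dist (u x) 0 < 1 / (2 * C)"
      using tendstoD[OF u_lim, of "1 / (2 * C)"] C(1) by simp
    moreover have "\<forall>\<^sub>F x in at w. x \<in> N" using w eventually_at_topological by blast
    ultimately show "\<forall>\<^sub>F x in at w. norm (K x - K w) \<le> 2 * C * norm (K w) * norm (u x)"
    proof eventually_elim
      case (elim x)
      have diff: "norm (K x - K w) \<le> norm (K x) * norm (u x) * C"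
        using id[OF elim(2)] C(2)[of "K x" "u x"] by (metis add_diff_cancel_left' diff_add_cancel norm_minus_commute)
      have "norm (u x) * C \<le> 1 / 2" using elim(1) C(1) by (simp add: field_simps)
      then have "norm (K x) * (norm (u x) * C) \<le> norm (K x) * (1 / 2)" by (intro mult_left_mono) auto
      then have "norm (K x) \<le> 2 * norm (K w)"
        using diff norm_triangle_sub[of "K x" "K w"] by (simp add: mult.assoc)
      then have "norm (K x) * norm (u x) * C \<le> 2 * norm (K w) * norm (u x) * C"
        using C(1) by (intro mult_right_mono) auto
      then show ?case using diff by (simp add: mult_ac)
    qed
  qed
  then have "isCont K w" by (simp add: isCont_def LIM_zero_iff)
  from has_derivative_diff[OF has_derivative_const[of "K w"] has_derivative_bilinear_vanishing[OF bil this du u0]]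
  have "((\<lambda>x. K w - m (K x) (u x)) has_derivative (\<lambda>\<xi>. m (- m (K w) (m (K w) F')) \<xi>)) (at w)"
    by (simp add: minus_left assoc)
  then show ?thesis
    by (rule has_derivative_transform_within_open[OF _ w]) (rule id[symmetric])
qed

text \<open>The vector that represents the linear functional \<open>y \<mapsto> (x y)\<^sub>k\<close>. It gives \<open>G\<^sub>k\<close> as a linear
  function of \<open>e/F\<close>.\<close>
definition dual_mult :: "(real^3 \<Rightarrow> real^3 \<Rightarrow> real^3) \<Rightarrow> 3 \<Rightarrow> real^3 \<Rightarrow> real^3" where
  "dual_mult m k x = (\<Sum>j\<in>UNIV. \<Sum>i\<in>UNIV. (struct_const m i j k * x $ i) *\<^sub>R bas j)"

lemma linear_dual_mult: "linear (dual_mult m k)"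
  by (rule linearI)
     (simp_all add: dual_mult_def sum.distrib scaleR_sum_right algebra_simps)

lemma dual_mult_inner:
  assumes "bilinear m"
  shows "dual_mult m k x \<bullet> y = m x y $ k"
proof -
  have ex: "z = (\<Sum>i\<in>UNIV. z $ i *\<^sub>R bas i)" for z :: "real^3"
    using basis_expansion[of z] by (simp add: scalar_mult_eq_scaleR)
  have "m x y = m (\<Sum>i\<in>UNIV. x $ i *\<^sub>R bas i) (\<Sum>j\<in>UNIV. y $ j *\<^sub>R bas j)"
    by (simp only: ex[symmetric])
  also have "\<dots> = (\<Sum>i\<in>UNIV. \<Sum>j\<in>UNIV. (x $ i * y $ j) *\<^sub>R m (bas i) (bas j))"
    by (simp add: bilinear_sum[OF assms] sum.cartesian_product bilinear_lmul[OF assms] bilinear_rmul[OF assms] case_prod_unfold mult.commute)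
  finally have "m x y $ k = (\<Sum>i\<in>UNIV. \<Sum>j\<in>UNIV. x $ i * y $ j * struct_const m i j k)"
    by (simp add: struct_const_def)
  also have "\<dots> = (\<Sum>j\<in>UNIV. \<Sum>i\<in>UNIV. x $ i * y $ j * struct_const m i j k)"
    by (rule sum.swap)
  also have "\<dots> = dual_mult m k x \<bullet> y"
    by (simp add: dual_mult_def inner_sum_left inner_axis' mult_ac)
  finally show ?thesis by simp
qed

lemma G_field_eq_dual_mult: "G_field m e F k w = dual_mult m k (reciprocal m e F w)"
  by (simp add: G_field_def dual_mult_def)

section \<open>Level sets of linear functionals of an antiderivative\<close>

text \<open>Continuity of a derivative as a map into the linear operators may be tested on basis vectors.\<close>
lemma C1_map_onI:
  fixes f :: "real^3 \<Rightarrow> real^3"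
  assumes der: "\<And>x. x \<in> U \<Longrightarrow> (f has_derivative f' x) (at x)"
    and cont: "\<And>i. i \<in> Basis \<Longrightarrow> continuous_on U (\<lambda>x. f' x i)"
  shows "C1_map_on U f"
  unfolding C1_map_on_def
proof (intro exI conjI ballI)
  have app: "blinfun_apply (Blinfun (f' x)) = f' x" if "x \<in> U" for x
    using has_derivative_bounded_linear[OF der[OF that]] by (rule bounded_linear_Blinfun_apply)
  show "(f has_derivative blinfun_apply (Blinfun (f' x))) (at x)" if "x \<in> U" for x
    using der[OF that] by (simp add: app[OF that])
  show "continuous_on U (\<lambda>x. Blinfun (f' x))"
  proof (rule continuous_on_blinfun_componentwise)
    fix i :: "real^3" assume i: "i \<in> Basis"
    show "continuous_on U (\<lambda>x. blinfun_apply (Blinfun (f' x)) i)"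
      by (rule continuous_on_eq[OF cont[OF i]]) (simp add: app)
  qed
qed

text \<open>The situation on \<open>N\<close> once an antiderivative \<open>H\<close> of \<open>K = e/F\<close> is given: the derivative of \<open>H\<close> is
  multiplication by \<open>K\<close>, which multiplication by \<open>F\<close> inverts.\<close>
locale local_alg_diffeo =
  fixes m :: "real^3 \<Rightarrow> real^3 \<Rightarrow> real^3" and N :: "(real^3) set" and H K F :: "real^3 \<Rightarrow> real^3"
  assumes bil: "bounded_bilinear m" and open_N: "open N"
    and der_H: "\<And>w. w \<in> N \<Longrightarrow> (H has_derivative m (K w)) (at w)"
    and cont_K: "continuous_on N K" and cont_F: "continuous_on N F"
    and FK: "\<And>w \<xi>. w \<in> N \<Longrightarrow> m (F w) (m (K w) \<xi>) = \<xi>"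
    and KF: "\<And>w \<xi>. w \<in> N \<Longrightarrow> m (K w) (m (F w) \<xi>) = \<xi>"
begin

text \<open>The inverse function theorem. The derivative of the inverse is explicit, which later gives its
  continuity. The orthogonal map \<open>R\<close> and the shift \<open>c\<close> are there to move a plane orthogonal to a given vector
  onto the plane on which the third coordinate vanishes.\<close>
lemma chart:
  fixes R :: "real^3 \<Rightarrow> real^3"
  assumes p: "p \<in> N" and R: "orthogonal_transformation R"
  obtains U V \<psi> where "open U" "p \<in> U" "U \<subseteq> N" "open V" "homeomorphism U V (\<lambda>x. R (H x) - c) \<psi>"
    "\<And>y. y \<in> V \<Longrightarrow> (\<psi> has_derivative (\<lambda>\<eta>. m (F (\<psi> y)) (inv R \<eta>))) (at y)"
proof -
  interpret bounded_bilinear m by (rule bil)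
  have R': "orthogonal_transformation (inv R)" using R by (rule orthogonal_transformation_inv)
  have bR: "bounded_linear R" "bounded_linear (inv R)"
    using orthogonal_transformation_linear[OF R] orthogonal_transformation_linear[OF R']
    by (simp_all add: linear_conv_bounded_linear)
  have "bij R" using R by (rule orthogonal_transformation_bij)
  then have RR: "inv R (R x) = x" "R (inv R x) = x" for x
    by (simp_all add: bij_is_inj bij_is_surj surj_f_inv_f)
  let ?\<phi> = "\<lambda>x. R (H x) - c"
  define \<phi>' where "\<phi>' x = Blinfun (\<lambda>\<xi>. R (m (K x) \<xi>))" for x
  define \<psi>' where "\<psi>' x = Blinfun (\<lambda>\<eta>. m (F x) (inv R \<eta>))" for x
  have \<phi>'_apply: "blinfun_apply (\<phi>' x) = (\<lambda>\<xi>. R (m (K x) \<xi>))" for x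
    unfolding \<phi>'_def by (rule bounded_linear_Blinfun_apply) (rule bounded_linear_compose[OF bR(1) bounded_linear_right])
  have \<psi>'_apply: "blinfun_apply (\<psi>' x) = (\<lambda>\<eta>. m (F x) (inv R \<eta>))" for x
    unfolding \<psi>'_def by (rule bounded_linear_Blinfun_apply) (rule bounded_linear_compose[OF bounded_linear_right bR(2)])
  have der: "(?\<phi> has_derivative blinfun_apply (\<phi>' x)) (at x)" if "x \<in> N" for x
  proof -
    have "((\<lambda>x. R (H x) - c) has_derivative (\<lambda>\<xi>. R (m (K x) \<xi>) - 0)) (at x)"
      by (intro has_derivative_diff has_derivative_const bounded_linear.has_derivative[OF bR(1)] der_H that)
    then show ?thesis by (simp add: \<phi>'_apply)
  qed
  have cont\<phi>': "continuous_on N \<phi>'"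
    by (rule continuous_on_blinfun_componentwise)
       (auto simp: \<phi>'_apply intro!: bounded_linear.continuous_on[OF bR(1)] continuous_on cont_K continuous_on_const)
  have inv0: "\<psi>' p o\<^sub>L \<phi>' p = id_blinfun"
    by (rule blinfun_eqI) (simp add: \<phi>'_apply \<psi>'_apply RR FK p)
  obtain U V \<psi> g' where UV: "open U" "U \<subseteq> N" "p \<in> U" "open V" "homeomorphism U V ?\<phi> \<psi>"
    and g: "\<And>y. y \<in> V \<Longrightarrow> (\<psi> has_derivative g' y) (at y)"
      "\<And>y. y \<in> V \<Longrightarrow> g' y = inv (blinfun_apply (\<phi>' (\<psi> y)))"
    using inverse_function_theorem[OF open_N der cont\<phi>' p inv0] by metis
  have "(\<psi> has_derivative (\<lambda>\<eta>. m (F (\<psi> y)) (inv R \<eta>))) (at y)" if y: "y \<in> V" for y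
  proof -
    have "\<psi> y \<in> N" using homeomorphism_image2[OF UV(5)] UV(2) y by blast
    then have "inv (blinfun_apply (\<phi>' (\<psi> y))) = (\<lambda>\<eta>. m (F (\<psi> y)) (inv R \<eta>))"
      by (intro inv_equality) (simp_all add: \<phi>'_apply RR FK KF)
    then show ?thesis using g y by metis
  qed
  then show thesis using that UV by blast
qed

text \<open>In the chart, let \<open>R\<close> map \<open>a\<close> to the third axis. Then the third coordinate of \<open>R (H w)\<close> is
  \<open>(a \<bullet> H w) / norm a\<close>.\<close>
lemma C1_surface_level_set:
  assumes a: "a \<noteq> 0"
  shows "C1_surface (level_set N (\<lambda>w. a \<bullet> H w) c)"
  unfolding C1_surface_def
proof
  let ?S = "level_set N (\<lambda>w. a \<bullet> H w) c"
  fix p assume "p \<in> ?S"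
  then have p: "p \<in> N" by (simp add: level_set_def)
  have "norm a = norm (norm a *\<^sub>R (axis 3 1 :: real^3))" by (simp add: norm_axis_1)
  then obtain R where R: "orthogonal_transformation R" "R a = norm a *\<^sub>R (axis 3 1 :: real^3)"
    by (rule orthogonal_transformation_exists)
  let ?c = "(c / norm a) *\<^sub>R axis 3 (1::real)"
  let ?\<phi> = "\<lambda>x. R (H x) - ?c"
  obtain U V \<psi> where UV: "open U" "p \<in> U" "U \<subseteq> N" "open V" "homeomorphism U V ?\<phi> \<psi>"
    and \<psi>: "\<And>y. y \<in> V \<Longrightarrow> (\<psi> has_derivative (\<lambda>\<eta>. m (F (\<psi> y)) (inv R \<eta>))) (at y)"
    by (rule chart[OF p R(1), where c = ?c]) (rule that)
  have bR: "bounded_linear R"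
    using orthogonal_transformation_linear[OF R(1)] by (simp add: linear_conv_bounded_linear)
  have "C1_map_on U ?\<phi>"
  proof (rule C1_map_onI)
    fix x assume "x \<in> U"
    then have "((\<lambda>x. R (H x) - ?c) has_derivative (\<lambda>\<xi>. R (m (K x) \<xi>) - 0)) (at x)"
      using UV(3) by (intro has_derivative_diff has_derivative_const bounded_linear.has_derivative[OF bR] der_H) blast
    then show "(?\<phi> has_derivative (\<lambda>\<xi>. R (m (K x) \<xi>))) (at x)" by simp
  next
    fix i :: "real^3"
    have "continuous_on U K" using cont_K UV(3) by (rule continuous_on_subset)
    then show "continuous_on U (\<lambda>x. R (m (K x) i))"
      by (intro bounded_linear.continuous_on[OF bR] bounded_bilinear.continuous_on[OF bil] continuous_on_const)
  qed
  moreover have "C1_map_on V \<psi>"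
  proof (rule C1_map_onI[OF \<psi>])
    fix i :: "real^3"
    have "continuous_on V \<psi>" "\<psi> ` V \<subseteq> N"
      using homeomorphism_cont2[OF UV(5)] homeomorphism_image2[OF UV(5)] UV(3) by auto
    then have "continuous_on V (\<lambda>y. F (\<psi> y))" by (rule continuous_on_compose2[OF cont_F])
    then show "continuous_on V (\<lambda>y. m (F (\<psi> y)) (inv R i))"
      by (intro bounded_bilinear.continuous_on[OF bil] continuous_on_const)
  qed
  moreover have "?\<phi> ` (?S \<inter> U) = {y \<in> V. y $ 3 = 0}"
  proof -
    have third: "?\<phi> x $ 3 = (a \<bullet> H x - c) / norm a" for x
    proof -
      have "norm a * R (H x) $ 3 = R (H x) \<bullet> R a" by (simp add: R(2) inner_axis)
      also have "\<dots> = H x \<bullet> a" using R(1) unfolding orthogonal_transformation_def by blast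
      finally show ?thesis using a by (simp add: field_simps inner_commute)
    qed
    have iff: "?\<phi> x $ 3 = 0 \<longleftrightarrow> a \<bullet> H x = c" for x unfolding third using a by simp
    have V: "V = ?\<phi> ` U" using homeomorphism_image1[OF UV(5)] by simp
    show ?thesis
      unfolding V level_set_def using UV(3) iff by blast
  qed
  ultimately show "\<exists>U V \<phi> \<psi>. open U \<and> open V \<and> p \<in> U \<and> homeomorphism U V \<phi> \<psi> \<and>
      C1_map_on U \<phi> \<and> C1_map_on V \<psi> \<and> \<phi> ` (?S \<inter> U) = {y \<in> V. y $ 3 = 0}"
    using UV by blast
qed

text \<open>The local inverse of \<open>H\<close> maps the straight line through \<open>H p\<close> with direction \<open>K p v\<close>, on which the
  functional is constant, to a curve in the level set with velocity \<open>F p (K p v) = v\<close>.\<close>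
lemma kernel_subset_tangent_space:
  assumes p: "p \<in> level_set N (\<lambda>w. a \<bullet> H w) c" and v: "a \<bullet> m (K p) v = 0"
  shows "v \<in> tangent_space (level_set N (\<lambda>w. a \<bullet> H w) c) p"
proof -
  have pN: "p \<in> N" and pc: "a \<bullet> H p = c" using p by (simp_all add: level_set_def)
  have id: "orthogonal_transformation (\<lambda>x::real^3. x)" by (simp add: orthogonal_transformation_def)
  have inv_id: "inv (\<lambda>x::real^3. x) = (\<lambda>x. x)" by (rule inv_equality) auto
  obtain U V \<psi> where UV0: "open U" "p \<in> U" "U \<subseteq> N" "open V" "homeomorphism U V (\<lambda>x. H x - 0) \<psi>"
    and \<psi>0: "\<And>y. y \<in> V \<Longrightarrow> (\<psi> has_derivative (\<lambda>\<eta>. m (F (\<psi> y)) (inv (\<lambda>x. x) \<eta>))) (at y)"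
    by (rule chart[OF pN id, where c = 0]) (rule that)
  note UV = UV0[unfolded diff_zero] and \<psi> = \<psi>0[unfolded inv_id]
  define l where "l t = H p + t *\<^sub>R m (K p) v" for t :: real
  define \<gamma> where "\<gamma> t = \<psi> (l t)" for t
  have l0: "l 0 = H p" by (simp add: l_def)
  have l0V: "l 0 \<in> V" using homeomorphism_image1[OF UV(5)] UV(2) l0 by auto
  have \<psi>l0: "\<psi> (l 0) = p" using homeomorphism_apply1[OF UV(5,2)] by (simp add: l0)
  have "isCont l 0" unfolding l_def by (intro continuous_intros)
  then have "\<forall>\<^sub>F t in at 0. l t \<in> V" using UV(4) l0V by (simp add: isCont_def topological_tendstoD)
  then obtain \<epsilon> where \<epsilon>: "\<epsilon> > 0" "\<And>t. t \<noteq> 0 \<Longrightarrow> dist t 0 < \<epsilon> \<Longrightarrow> l t \<in> V"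
    unfolding eventually_at by auto
  have lV: "l t \<in> V" if "\<bar>t\<bar> < \<epsilon>" for t using \<epsilon>(2)[of t] l0V that by (cases "t = 0") auto
  have "\<gamma> t \<in> level_set N (\<lambda>w. a \<bullet> H w) c" if "\<bar>t\<bar> < \<epsilon>" for t
  proof -
    have "H (\<gamma> t) = l t" using homeomorphism_apply2[OF UV(5) lV[OF that]] by (simp add: \<gamma>_def)
    moreover have "\<gamma> t \<in> N" using homeomorphism_image2[OF UV(5)] lV[OF that] UV(3) by (auto simp: \<gamma>_def)
    ultimately show ?thesis by (simp add: level_set_def l_def inner_add_right v pc)
  qed
  moreover have "(\<gamma> has_vector_derivative v) (at 0)"
  proof -
    have "(l has_derivative (\<lambda>s. s *\<^sub>R m (K p) v)) (at 0)"
      unfolding l_def by (auto intro!: derivative_eq_intros)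
    from has_derivative_compose[OF this \<psi>[OF l0V]]
    have "(\<gamma> has_derivative (\<lambda>s. m (F p) (s *\<^sub>R m (K p) v))) (at 0)" by (simp add: \<gamma>_def[abs_def] \<psi>l0)
    then show ?thesis
      by (simp add: has_vector_derivative_def bounded_bilinear.scaleR_right[OF bil] FK[OF pN])
  qed
  moreover have "\<gamma> 0 = p" by (simp add: \<gamma>_def \<psi>l0)
  ultimately show ?thesis unfolding tangent_space_def using \<epsilon>(1) by blast
qed

text \<open>The vector \<open>\<eta>\<close> is a witness for linear independence. After multiplication by \<open>K p\<close>, split a given
  vector into its multiple of \<open>\<eta>\<close>, which \<open>a\<close> annihilates, and a rest annihilated by \<open>b\<close>.\<close>
lemma transversal_intersections_functionals:
  assumes a: "a \<noteq> 0" and \<eta>: "a \<bullet> \<eta> = 0" "b \<bullet> \<eta> = 1"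
  shows "transversal_intersections N (\<lambda>w. a \<bullet> H w) (\<lambda>w. b \<bullet> H w)"
  unfolding transversal_intersections_def intersect_transversally_def
proof (intro allI impI conjI ballI)
  fix c1 c2
  show "C1_surface (level_set N (\<lambda>w. a \<bullet> H w) c1)" by (rule C1_surface_level_set[OF a])
  have "b \<noteq> 0" using \<eta>(2) by auto
  then show "C1_surface (level_set N (\<lambda>w. b \<bullet> H w) c2)" by (rule C1_surface_level_set)
  let ?S = "level_set N (\<lambda>w. a \<bullet> H w) c1" and ?T = "level_set N (\<lambda>w. b \<bullet> H w) c2"
  fix p assume p: "p \<in> ?S \<inter> ?T"
  then have pN: "p \<in> N" by (simp add: level_set_def)
  interpret bounded_bilinear m by (rule bil)
  have "\<exists>u v. \<xi> = u + v \<and> u \<in> tangent_space ?S p \<and> v \<in> tangent_space ?T p" for \<xi>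
  proof -
    define u where "u = m (F p) ((b \<bullet> m (K p) \<xi>) *\<^sub>R \<eta>)"
    have Ku: "m (K p) u = (b \<bullet> m (K p) \<xi>) *\<^sub>R \<eta>" unfolding u_def by (rule KF[OF pN])
    have "u \<in> tangent_space ?S p"
      using p by (intro kernel_subset_tangent_space) (simp_all add: Ku \<eta>)
    moreover have "\<xi> - u \<in> tangent_space ?T p"
      using p by (intro kernel_subset_tangent_space) (simp_all add: diff_right Ku inner_diff_right \<eta>)
    ultimately show ?thesis by (intro exI[of _ u] exI[of _ "\<xi> - u"]) simp
  qed
  then show "{u + v |u v. u \<in> tangent_space ?S p \<and> v \<in> tangent_space ?T p} = UNIV" by blast
qed

text \<open>The gradient of \<open>a \<bullet> H\<close> at \<open>w\<close> is the image of \<open>a\<close> under the adjoint of multiplication by \<open>K w\<close>.\<close>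
lemma first_integral_functional:
  assumes a: "\<And>w. w \<in> N \<Longrightarrow> a \<bullet> m (K w) (F w) = 0"
  shows "first_integral_on N F (\<lambda>w. a \<bullet> H w)"
  unfolding first_integral_on_def
proof
  fix w assume w: "w \<in> N"
  have lin: "linear (m (K w))" using der_H[OF w] by (rule has_derivative_linear)
  let ?D = "adjoint (m (K w)) a"
  have D: "?D \<bullet> \<xi> = a \<bullet> m (K w) \<xi>" for \<xi>
    using adjoint_works[OF lin, of \<xi> a] by (simp add: inner_commute)
  have "((\<lambda>w. a \<bullet> H w) has_derivative (\<lambda>\<xi>. a \<bullet> m (K w) \<xi>)) (at w)"
    by (rule has_derivative_inner_right[OF der_H[OF w]])
  then have "GDERIV (\<lambda>w. a \<bullet> H w) w :> ?D"
    unfolding gderiv_def by (simp add: D inner_commute[of _ ?D])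
  then show "\<exists>D. GDERIV (\<lambda>w. a \<bullet> H w) w :> D \<and> D \<bullet> F w = 0"
    using D[of "F w"] a[OF w] by auto
qed

lemma transversal_first_integrals_functionals:
  assumes e: "\<And>w. w \<in> N \<Longrightarrow> m (K w) (F w) = e"
    and a: "a \<noteq> 0" "a \<bullet> e = 0" "a \<bullet> \<eta> = 0" and b: "b \<bullet> e = 0" "b \<bullet> \<eta> = 1"
  shows "transversal_first_integrals N F (\<lambda>w. a \<bullet> H w) (\<lambda>w. b \<bullet> H w)"
  unfolding transversal_first_integrals_def
  using first_integral_functional[of a] first_integral_functional[of b]
    transversal_intersections_functionals[of a \<eta> b] a b e by simp

end

section \<open>The characterization of antiderivatives and the first integrals\<close>

lemma distinct_if_exhausts_3:
  fixes r s t :: 3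
  assumes "{r, s, t} = {1, 2, 3}"
  shows "r \<noteq> s" "r \<noteq> t" "s \<noteq> t"
proof -
  have "card {r, s, t} = 3" unfolding assms by simp
  then show "r \<noteq> s" "r \<noteq> t" "s \<noteq> t" by (auto simp: card_insert_if split: if_splits)
qed

lemma has_alg_derivative_of_components:
  fixes h :: "3 \<Rightarrow> real^3 \<Rightarrow> real"
  assumes h: "\<And>k. (h k has_derivative (\<lambda>\<xi>. m a \<xi> $ k)) (at w)"
  shows "((\<lambda>w. v + (\<chi> k. h k w - c k)) has_derivative m a) (at w)"
proof -
  have ex: "(\<Sum>i\<in>UNIV. z $ i *\<^sub>R bas i) = z" for z :: "real^3"
    using basis_expansion[of z] by (simp add: scalar_mult_eq_scaleR)
  have "((\<lambda>w. v + (\<Sum>k\<in>UNIV. (h k w - c k) *\<^sub>R bas k)) has_derivative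
      (\<lambda>\<xi>. \<Sum>k\<in>UNIV. m a \<xi> $ k *\<^sub>R bas k)) (at w)"
    by (auto intro!: derivative_eq_intros h)
  moreover have "(\<Sum>k\<in>UNIV. (h k w - c k) *\<^sub>R bas k) = (\<chi> k. h k w - c k)" for w
    using ex[of "\<chi> k. h k w - c k"] by simp
  ultimately show ?thesis by (simp add: ex)
qed

theorem proposition4p4:
  fixes m :: "real^3 \<Rightarrow> real^3 \<Rightarrow> real^3" and e :: "real^3"
    and F :: "real^3 \<Rightarrow> real^3" and \<Omega> N :: "(real^3) set" and w0 :: "real^3"
  assumes "R3_algebra m e"
    and "open \<Omega>" and "algebrizable_on m F \<Omega>"
    and "w0 \<in> unit_domain m e F \<Omega>"
    and "open N" and "simply_connected N" and "w0 \<in> N" and "N \<subseteq> unit_domain m e F \<Omega>"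
  shows
    "(\<forall>k. \<forall>w\<in>N. \<exists>I. \<forall>\<gamma>\<in>curves N w0 w. has_line_integral (G_field m e F k) I \<gamma>) \<and>
     (\<forall>H :: real^3 \<Rightarrow> real^3.
        alg_antiderivative_on m H (reciprocal m e F) N \<longleftrightarrow>
        (\<forall>w\<in>N. \<forall>\<gamma>\<in>curves N w0 w.
           H w = H w0 + (\<chi> k. line_integral (G_field m e F k) \<gamma>))) \<and>
     (\<forall>H :: real^3 \<Rightarrow> real^3. alg_antiderivative_on m H (reciprocal m e F) N \<longrightarrow>
        (\<forall>r s t :: 3. {r, s, t} = {1, 2, 3} \<longrightarrow>
           (\<forall>p1 p2 p3 p4 p5 p6. is_A3_r m e r s t p1 p2 p3 p4 p5 p6 \<longrightarrow>
              transversal_first_integrals N F (\<lambda>w. H w $ s) (\<lambda>w. H w $ t)) \<and>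
           (\<forall>p1 p2. is_A3_rs m e r s t p1 p2 \<longrightarrow>
              transversal_first_integrals N F
                (\<lambda>w. H w $ r - H w $ s) (\<lambda>w. H w $ r - H w $ s + H w $ t)) \<and>
           (is_A3_123 m e \<longrightarrow>
              transversal_first_integrals N F
                (\<lambda>w. H w $ r - H w $ t) (\<lambda>w. H w $ r - H w $ s))))"
proof -
  note alg = assms(1) and open_N = assms(5) and sc_N = assms(6) and w0 = assms(7)
  have bil: "bilinear m" using alg by (simp add: R3_algebra_def)
  then have bbil: "bounded_bilinear m" by (simp add: bilinear_conv_bounded_bilinear)
  have assoc: "m (m x y) z = m x (m y z)" and comm: "m x y = m y x" and unit: "m e x = x" for x y z
    using alg by (auto simp: R3_algebra_def)
  let ?K = "reciprocal m e F" and ?G = "G_field m e F"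
  obtain F' where F': "\<And>w. w \<in> \<Omega> \<Longrightarrow> (F has_derivative m (F' w)) (at w)"
    using assms(3) unfolding algebrizable_on_def has_alg_derivative_on_def by auto
  have N\<Omega>: "w \<in> \<Omega>" and Funit: "F w \<in> alg_units m e" if "w \<in> N" for w
    using assms(8) that by (auto simp: unit_domain_def)
  have F_recip: "m (F w) (?K w) = e" if "w \<in> N" for w
    unfolding reciprocal_def by (rule alg_inverse_right[OF alg Funit[OF that]])
  define K' where "K' w = - m (?K w) (m (?K w) (F' w))" for w
  have K': "(?K has_derivative m (K' w)) (at w)" if "w \<in> N" for w
    unfolding K'_def by (rule has_derivative_alg_inverse[OF alg open_N that F_recip F'[OF N\<Omega>[OF that]]])
  have G_inner: "?G k w \<bullet> \<xi> = m (?K w) \<xi> $ k" for k w \<xi>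
    by (simp add: G_field_eq_dual_mult dual_mult_inner[OF bil])

  \<comment> \<open>The fields \<open>G\<^sub>k\<close> are closed because \<open>(K' u) v = (K' v) u\<close>.\<close>
  have "\<exists>h. \<forall>w\<in>N. (h has_derivative (\<lambda>\<xi>. ?G k w \<bullet> \<xi>)) (at w)" for k
  proof -
    have bl: "bounded_linear (dual_mult m k)"
      using linear_dual_mult by (simp add: linear_conv_bounded_linear)
    have der: "(?G k has_derivative (\<lambda>\<xi>. dual_mult m k (m (K' w) \<xi>))) (at w)" if "w \<in> N" for w
      unfolding G_field_eq_dual_mult[abs_def] by (rule bounded_linear.has_derivative[OF bl K'[OF that]])
    have sym: "dual_mult m k (m (K' w) u) \<bullet> v = u \<bullet> dual_mult m k (m (K' w) v)" for w u v
    proof -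
      have "m (m (K' w) u) v = m (m (K' w) v) u" by (metis assoc comm)
      then show ?thesis by (metis dual_mult_inner[OF bil] inner_commute)
    qed
    obtain h where "\<And>w. w \<in> N \<Longrightarrow> (h has_derivative (\<lambda>\<xi>. ?G k w \<bullet> \<xi>)) (at w)"
      by (rule closed_field_has_potential[OF open_N sc_N der sym]) (assumption, rule that)
    then show ?thesis by blast
  qed
  then obtain h where h: "\<And>k w. w \<in> N \<Longrightarrow> (h k has_derivative (\<lambda>\<xi>. ?G k w \<bullet> \<xi>)) (at w)" by metis

  have FTC: "has_line_integral (?G k) (f w - f w0) \<gamma>"
    if "\<And>w. w \<in> N \<Longrightarrow> (f has_derivative (\<lambda>\<xi>. ?G k w \<bullet> \<xi>)) (at w)" "\<gamma> \<in> curves N w0 w" for f k w \<gamma>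
    using gradient_line_integral[of N f "?G k" \<gamma>] that unfolding has_line_integral_def curves_def by auto
  have line_integral_eq: "line_integral G \<gamma> = I" if "has_line_integral G I \<gamma>" for G I \<gamma>
    using that unfolding has_line_integral_def line_integral_def by (rule integral_unique)

  have path_independent: "\<forall>k. \<forall>w\<in>N. \<exists>I. \<forall>\<gamma>\<in>curves N w0 w. has_line_integral (?G k) I \<gamma>"
    using FTC[OF h] by blast
  have antiderivative_iff: "alg_antiderivative_on m H ?K N \<longleftrightarrow>
      (\<forall>w\<in>N. \<forall>\<gamma>\<in>curves N w0 w. H w = H w0 + (\<chi> k. line_integral (?G k) \<gamma>))" for H
  proof (intro iffI ballI)
    fix w \<gamma> assume H: "alg_antiderivative_on m H ?K N" and \<gamma>: "\<gamma> \<in> curves N w0 w"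
    have "((\<lambda>w. H w $ k) has_derivative (\<lambda>\<xi>. ?G k w \<bullet> \<xi>)) (at w)" if "w \<in> N" for k w
      unfolding G_inner
      using H that bounded_linear.has_derivative[OF bounded_linear_vec_nth]
      unfolding alg_antiderivative_on_def has_alg_derivative_on_def by blast
    then have "line_integral (?G k) \<gamma> = H w $ k - H w0 $ k" for k
      by (intro line_integral_eq FTC[OF _ \<gamma>])
    then show "H w = H w0 + (\<chi> k. line_integral (?G k) \<gamma>)" by (simp add: vec_eq_iff)
  next
    assume H: "\<forall>w\<in>N. \<forall>\<gamma>\<in>curves N w0 w. H w = H w0 + (\<chi> k. line_integral (?G k) \<gamma>)"
    \<comment> \<open>The condition on \<open>H\<close> speaks about a point only if a curve leads there; \<open>N\<close> is
        connected, so every point of \<open>N\<close> is reached.\<close>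
    have eq: "H w0 + (\<chi> k. h k w - h k w0) = H w" if w: "w \<in> N" for w
    proof -
      obtain \<gamma> where "valid_path \<gamma>" "path_image \<gamma> \<subseteq> N" "pathstart \<gamma> = w0" "pathfinish \<gamma> = w"
        using connected_open_valid_path[OF open_N simply_connected_imp_connected[OF sc_N] w0 w] by metis
      then have \<gamma>: "\<gamma> \<in> curves N w0 w" by (simp add: curves_def)
      have "line_integral (?G k) \<gamma> = h k w - h k w0" for k
        by (intro line_integral_eq FTC[OF h \<gamma>])
      then show ?thesis using H w \<gamma> by simp
    qed
    show "alg_antiderivative_on m H ?K N"
      unfolding alg_antiderivative_on_def has_alg_derivative_on_def
    proof
      fix w assume w: "w \<in> N"
      have "((\<lambda>w. H w0 + (\<chi> k. h k w - h k w0)) has_derivative m (?K w)) (at w)"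
        by (rule has_alg_derivative_of_components) (rule h[OF w, unfolded G_inner])
      then have "(H has_derivative m (?K w)) (at w)"
        by (rule has_derivative_transform_within_open[OF _ open_N w]) (rule eq)
      then show "(H has_derivative (\<lambda>\<xi>. m (?K w) \<xi>)) (at w)" by simp
    qed
  qed
  have first_integrals:
    "(\<forall>p1 p2 p3 p4 p5 p6. is_A3_r m e r s t p1 p2 p3 p4 p5 p6 \<longrightarrow>
        transversal_first_integrals N F (\<lambda>w. H w $ s) (\<lambda>w. H w $ t)) \<and>
     (\<forall>p1 p2. is_A3_rs m e r s t p1 p2 \<longrightarrow>
        transversal_first_integrals N F
          (\<lambda>w. H w $ r - H w $ s) (\<lambda>w. H w $ r - H w $ s + H w $ t)) \<and>
     (is_A3_123 m e \<longrightarrow>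
        transversal_first_integrals N F
          (\<lambda>w. H w $ r - H w $ t) (\<lambda>w. H w $ r - H w $ s))"
    if H: "alg_antiderivative_on m H ?K N" and rst: "{r, s, t} = {1, 2, 3}" for H r s t
  proof -
    interpret local_alg_diffeo m N H ?K F
    proof (rule local_alg_diffeo.intro)
      show "bounded_bilinear m" by (rule bbil)
      show "open N" by (rule open_N)
      show "(H has_derivative m (?K w)) (at w)" if "w \<in> N" for w
        using H that unfolding alg_antiderivative_on_def has_alg_derivative_on_def by simp
      show "continuous_on N ?K"
        by (intro continuous_at_imp_continuous_on ballI has_derivative_continuous[OF K'])
      show "continuous_on N F"
        by (intro continuous_at_imp_continuous_on ballI has_derivative_continuous[OF F'[OF N\<Omega>]])
      show "m (F w) (m (?K w) \<xi>) = \<xi>" if "w \<in> N" for w \<xi>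
        using F_recip[OF that] assoc unit by metis
      show "m (?K w) (m (F w) \<xi>) = \<xi>" if "w \<in> N" for w \<xi>
        using F_recip[OF that] assoc comm unit by metis
    qed
    have KF_e: "m (?K w) (F w) = e" if "w \<in> N" for w using F_recip[OF that] comm by simp
    note transversal = transversal_first_integrals_functionals[OF KF_e]
    note ne = distinct_if_exhausts_3[OF rst] distinct_if_exhausts_3[OF rst, symmetric]
    have bas_inner: "bas i \<bullet> bas j = (if i = j then 1 else 0)" for i j :: 3
      by (simp add: inner_axis_axis)
    note inner_simps = inner_add_left inner_add_right inner_diff_left inner_diff_right inner_minus_right bas_inner ne
    have "transversal_first_integrals N F (\<lambda>w. H w $ s) (\<lambda>w. H w $ t)" if e: "e = bas r"
    proof -
      have "transversal_first_integrals N F (\<lambda>w. bas s \<bullet> H w) (\<lambda>w. bas t \<bullet> H w)"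
        by (rule transversal[where \<eta> = "bas t"]) (simp_all add: inner_simps e)
      then show ?thesis by (simp add: inner_axis')
    qed
    moreover have "transversal_first_integrals N F
        (\<lambda>w. H w $ r - H w $ s) (\<lambda>w. H w $ r - H w $ s + H w $ t)" if e: "e = bas r + bas s"
    proof -
      have "(bas r - bas s) \<bullet> bas r = 1" by (simp add: inner_simps)
      then have nz: "bas r - bas s \<noteq> 0" by auto
      have "transversal_first_integrals N F
          (\<lambda>w. (bas r - bas s) \<bullet> H w) (\<lambda>w. (bas r - bas s + bas t) \<bullet> H w)"
        by (rule transversal[where \<eta> = "bas t"]) (use nz in \<open>simp_all add: inner_simps e\<close>)
      then show ?thesis by (simp add: inner_axis' inner_add_left inner_diff_left)
    qed
    moreover have "transversal_first_integrals N F
        (\<lambda>w. H w $ r - H w $ t) (\<lambda>w. H w $ r - H w $ s)" if e: "e = bas 1 + bas 2 + bas 3"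
    proof -
      have e1: "bas i \<bullet> e = 1" for i
        using exhaust_3[of i] by (auto simp: e inner_add_right bas_inner)
      have "(bas r - bas t) \<bullet> bas r = 1" by (simp add: inner_simps)
      then have nz: "bas r - bas t \<noteq> 0" by auto
      have "transversal_first_integrals N F
          (\<lambda>w. (bas r - bas t) \<bullet> H w) (\<lambda>w. (bas r - bas s) \<bullet> H w)"
        by (rule transversal[where \<eta> = "- bas s"]) (use nz in \<open>simp_all add: e1 inner_simps\<close>)
      then show ?thesis by (simp add: inner_axis' inner_diff_left)
    qed
    ultimately show ?thesis unfolding is_A3_r_def is_A3_rs_def is_A3_123_def by blast
  qed
  show ?thesis
  proof (rule conjI[OF path_independent conjI])
    show "\<forall>H. alg_antiderivative_on m H ?K N \<longleftrightarrow>
        (\<forall>w\<in>N. \<forall>\<gamma>\<in>curves N w0 w. H w = H w0 + (\<chi> k. line_integral (?G k) \<gamma>))"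
      by (rule allI) (rule antiderivative_iff)
  qed (rule allI impI first_integrals | assumption)+
qed

end
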